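(* Let $f(\cdot;i):\mathbb{R}^d\to\mathbb{R}$, $i\in[n]$, and $F(w)=\frac1n\sum_{i=1}^n f(w;i)$. Assume: (a) $\mathrm{dom}(F)\neq\emptyset$ and $F_*:=\inf_{w\in\mathbb{R}^d}F(w)>-\infty$; (b) there is $L>0$ such that for every $i\in[n]$ and all $w,w'\in\mathrm{dom}(F)$, $\|\nabla f(w;i)-\nabla f(w';i)\|\le L\|w-w'\|$; (c) there are finite constants $\Theta,\sigma\ge 0$ such that for all $w\in\mathrm{dom}(F)$, $\frac1n\sum_{i=1}^n\|\nabla f(w;i)-\nabla F(w)\|^2\le\Theta\|\nabla F(w)\|^2+\sigma^2$. Let $0\le\beta<1$ and $D:=\max\left(\frac53,\frac{6(5-3\beta)(\Theta+n)}{n(1-\beta)}\right)$. Run the SMG algorithm (described in the context) under the randomized reshuffling strategy, with momentum weight $\beta$ and diminishing learning rate $\eta_t:=\frac{\gamma n^{1/3}}{(t+\lambda)^{1/3}}$, $t\ge1$, for some $\gamma>0$ and $\lambda\ge0$ such that $\eta_1=\frac{\gamma n^{1/3}}{(1+\lambda)^{1/3}}\le\frac{1}{L\sqrt D}$. Then, after $T$ epochs with $T\ge2$, $$\mathbb{E}\big[\|\nabla F(\hat w_T)\|^2\big]\le\frac{C_3+C_4\log(T-1+\lambda)}{n^{1/3}\left[(T+\lambda)^{2/3}-(1+\lambda)^{2/3}\right]},$$ where $$C_3:=\frac{4[F(\tilde w_0)-F_*]}{(1-\beta)\gamma}+\frac{12\sigma^2(5-3\beta)L^2\gamma^2}{(1-\beta)(1+\lambda)},\qquad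 C_4:=\frac{6\sigma^2(5-3\beta)L^2\gamma^2}{1-\beta}.$$ Consequently, the convergence rate of the algorithm is $\mathcal{O}(n^{-1/3}T^{-2/3}\log(T))$ in epoch.
   Context: $[n]=\{1,\dots,n\}$; $\|\cdot\|$ is the Euclidean norm; $\log$ is the natural logarithm; $\mathbb{E}$ is expectation over all randomness (permutations and output). Since each $f(\cdot;i)$ is real-valued on $\mathbb{R}^d$, $\mathrm{dom}(F)=\mathbb{R}^d$; each $f(\cdot;i)$ is differentiable. SMG algorithm (Shuffling Momentum Gradient), with parameters $\beta$, number of epochs $T\ge1$, and $\eta_t$: Choose $\tilde w_0\in\mathbb{R}^d$ (deterministic) and set $\tilde m_0:=0$. For $t=1,\dots,T$: set $w_0^{(t)}:=\tilde w_{t-1}$, $m_0^{(t)}:=\tilde m_{t-1}$, $v_0^{(t)}:=0$; generate a permutation $\pi^{(t)}$ of $[n]$; for $i=0,\dots,n-1$ put $g_i^{(t)}:=\nabla f(w_i^{(t)};\pi^{(t)}(i+1))$ and $$m_{i+1}^{(t)}:=\beta m_0^{(t)}+(1-\beta)g_i^{(t)},\quad v_{i+1}^{(t)}:=v_i^{(t)}+\tfrac1n g_i^{(t)},\quad w_{i+1}^{(t)}:=w_i^{(t)}-\tfrac{\eta_t}{n}m_{i+1}^{(t)};$$ then set $\tilde w_t:=w_n^{(t)}$ and $\tilde m_t:=v_n^{(t)}$. Output: $\hat w_T\in\{\tilde w_0,\dots,\tilde w_{T-1}\}$ chosen at random (independently of the permutations) with probability $\mathbb{P}[\hat w_T=\tilde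 w_{t-1}]=\eta_t/\sum_{s=1}^T\eta_s$. Randomized reshuffling strategy: at each epoch $t$, $\pi^{(t)}=(\pi^{(t)}(1),\dots,\pi^{(t)}(n))$ is uniformly sampled at random without replacement from $\{1,\dots,n\}$ (a uniformly random permutation), independently of the previous epochs. *)

theory Defs
  imports "HOL-Probability.Probability" "HOL-Combinatorics.Permutations"
begin

definition grad :: "('a::real_inner \<Rightarrow> real) \<Rightarrow> 'a \<Rightarrow> 'a" where
  "grad h w = (THE D. GDERIV h w :> D)"

lemma GDERIV_grad:
  fixes h :: "'a::euclidean_space \<Rightarrow> real"
  assumes "h differentiable (at w)"
  shows "GDERIV h w :> grad h w"
proof -
  obtain h' where h': "(h has_derivative h') (at w)"
    using assms by (auto simp: differentiable_def)
  then interpret bounded_linear h' by (rule has_derivative_bounded_linear)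
  let ?D = "\<Sum>b\<in>Basis. h' b *\<^sub>R b"
  have eq: "h' x = inner x ?D" for x
  proof -
    have "h' x = h' (\<Sum>b\<in>Basis. inner x b *\<^sub>R b)" by (simp add: euclidean_representation)
    also have "\<dots> = inner x ?D"
      by (simp add: sum scaleR inner_sum_right mult.commute)
    finally show ?thesis .
  qed
  have "GDERIV h w :> ?D"
    using h' eq unfolding gderiv_def by (metis (no_types, lifting) ext)
  moreover have "E = ?D" if "GDERIV h w :> E" for E
  proof -
    have "(\<lambda>x. inner x E) = h'"
      using that h' has_derivative_unique unfolding gderiv_def by blast
    then have "inner x E = inner x ?D" for x using eq by metis
    then show ?thesis by (metis vector_eq_ldot)
  qed
  ultimately show ?thesis unfolding grad_def by (rule theI)
qed

definition objective :: "nat \<Rightarrow> (nat \<Rightarrow> 'a \<Rightarrow> real) \<Rightarrow> 'a \<Rightarrow> real" where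
  "objective n f w = (1 / real n) * (\<Sum>i=1..n. f i w)"

definition objective_inf :: "nat \<Rightarrow> (nat \<Rightarrow> 'a \<Rightarrow> real) \<Rightarrow> real" where
  "objective_inf n f = (INF w. objective n f w)"

text \<open>Components are real-valued on the whole space, so the domain of the objective is everything
  and its nonemptiness is automatic.\<close>

definition finite_sum_problem ::
  "nat \<Rightarrow> (nat \<Rightarrow> 'a::euclidean_space \<Rightarrow> real) \<Rightarrow> real \<Rightarrow> real \<Rightarrow> real \<Rightarrow> bool" where
  "finite_sum_problem n f L \<Theta> \<sigma> \<longleftrightarrow>
     1 \<le> n \<and>
     (\<forall>i\<in>{1..n}. \<forall>w. f i differentiable (at w)) \<and>
     bdd_below (range (objective n f)) \<and>
     0 < L \<and>
     (\<forall>i\<in>{1..n}. \<forall>w w'. norm (grad (f i) w - grad (f i) w') \<le> L * norm (w - w')) \<and>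
     0 \<le> \<Theta> \<and> 0 \<le> \<sigma> \<and>
     (\<forall>w. (1 / real n) * (\<Sum>i=1..n. (norm (grad (f i) w - grad (objective n f) w))\<^sup>2)
            \<le> \<Theta> * (norm (grad (objective n f) w))\<^sup>2 + \<sigma>\<^sup>2)"

text \<open>\<open>smg_inner n f \<beta> h \<pi> w0 m0 i\<close> is the triple \<open>(w\<^sub>i, m\<^sub>i, v\<^sub>i)\<close> within one epoch with learning rate
  \<open>h\<close>, permutation \<open>\<pi>\<close>, starting point \<open>w0\<close> and momentum \<open>m0\<close>.\<close>

primrec smg_inner ::
  "nat \<Rightarrow> (nat \<Rightarrow> 'a::euclidean_space \<Rightarrow> real) \<Rightarrow> real \<Rightarrow> real \<Rightarrow> (nat \<Rightarrow> nat) \<Rightarrow> 'a \<Rightarrow> 'a \<Rightarrow> nat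
     \<Rightarrow> 'a \<times> 'a \<times> 'a" where
  "smg_inner n f \<beta> h \<pi> w0 m0 0 = (w0, m0, 0)"
| "smg_inner n f \<beta> h \<pi> w0 m0 (Suc i) =
     (let (w, m, v) = smg_inner n f \<beta> h \<pi> w0 m0 i;
          g = grad (f (\<pi> (i + 1))) w;
          m' = \<beta> *\<^sub>R m0 + (1 - \<beta>) *\<^sub>R g;
          v' = v + (1 / real n) *\<^sub>R g;
          w' = w - (h / real n) *\<^sub>R m'
      in (w', m', v'))"

text \<open>The pair of iterate and momentum after \<open>t\<close> epochs, where epoch \<open>t\<close> uses learning rate
  \<open>\<eta> t\<close> and permutation \<open>\<pi> t\<close>. The momentum carried over is the last component \<open>v\<close>.\<close>

primrec smg ::
  "nat \<Rightarrow> (nat \<Rightarrow> 'a::euclidean_space \<Rightarrow> real) \<Rightarrow> real \<Rightarrow> (nat \<Rightarrow> real) \<Rightarrow> 'a \<Rightarrow> (nat \<Rightarrow> nat \<Rightarrow> nat) \<Rightarrow> nat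
     \<Rightarrow> 'a \<times> 'a" where
  "smg n f \<beta> \<eta> w0 \<pi> 0 = (w0, 0)"
| "smg n f \<beta> \<eta> w0 \<pi> (Suc t) =
     (let (w, m) = smg n f \<beta> \<eta> w0 \<pi> t;
          (w', m', v') = smg_inner n f \<beta> (\<eta> (Suc t)) (\<pi> (Suc t)) w m n
      in (w', v'))"

definition smg_iterate ::
  "nat \<Rightarrow> (nat \<Rightarrow> 'a::euclidean_space \<Rightarrow> real) \<Rightarrow> real \<Rightarrow> (nat \<Rightarrow> real) \<Rightarrow> 'a \<Rightarrow> (nat \<Rightarrow> nat \<Rightarrow> nat) \<Rightarrow> nat
     \<Rightarrow> 'a" where
  "smg_iterate n f \<beta> \<eta> w0 \<pi> t = fst (smg n f \<beta> \<eta> w0 \<pi> t)"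

text \<open>Randomized reshuffling: independent uniform permutations of \<open>{1..n}\<close> for the epochs \<open>1..T\<close>.\<close>

definition reshuffling_pmf :: "nat \<Rightarrow> nat \<Rightarrow> (nat \<Rightarrow> nat \<Rightarrow> nat) pmf" where
  "reshuffling_pmf n T = Pi_pmf {1..T} id (\<lambda>_. pmf_of_set {p. p permutes {1..n}})"

definition epoch_pmf :: "(nat \<Rightarrow> real) \<Rightarrow> nat \<Rightarrow> nat pmf" where
  "epoch_pmf \<eta> T = embed_pmf (\<lambda>t. if t \<in> {1..T} then \<eta> t / (\<Sum>s=1..T. \<eta> s) else 0)"

lemma pmf_epoch_pmf:
  assumes "1 \<le> T" and "\<And>t. t \<in> {1..T} \<Longrightarrow> 0 < \<eta> t"
  shows "pmf (epoch_pmf \<eta> T) t = (if t \<in> {1..T} then \<eta> t / (\<Sum>s=1..T. \<eta> s) else 0)"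
proof -
  let ?p = "\<lambda>t. if t \<in> {1..T} then \<eta> t / (\<Sum>s=1..T. \<eta> s) else 0"
  have pos: "0 < (\<Sum>s=1..T. \<eta> s)" using assms by (intro sum_pos) auto
  have nonneg: "0 \<le> ?p t" for t
    using pos assms(2)[of t] by (auto intro!: divide_nonneg_nonneg)
  have "(\<integral>\<^sup>+ t. ennreal (?p t) \<partial>count_space UNIV) =
        (\<integral>\<^sup>+ t. ennreal (\<eta> t / (\<Sum>s=1..T. \<eta> s)) * indicator {1..T} t \<partial>count_space UNIV)"
    by (intro nn_integral_cong) (auto simp: indicator_def)
  also have "\<dots> = (\<Sum>t=1..T. ennreal (\<eta> t / (\<Sum>s=1..T. \<eta> s)))"
    by (simp add: nn_integral_count_space_indicator[symmetric] nn_integral_count_space_finite)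
  also have "\<dots> = ennreal (\<Sum>t=1..T. \<eta> t / (\<Sum>s=1..T. \<eta> s))"
    using pos assms(2) by (intro sum_ennreal) (auto intro!: divide_nonneg_nonneg less_imp_le)
  also have "(\<Sum>t=1..T. \<eta> t / (\<Sum>s=1..T. \<eta> s)) = 1"
    using pos by (simp add: sum_divide_distrib[symmetric])
  finally show ?thesis
    unfolding epoch_pmf_def using nonneg by (intro pmf_embed_pmf) auto
qed

text \<open>The output is the iterate after \<open>t - 1\<close> epochs, with \<open>t\<close> drawn independently of the
  permutations. All distributions here have finite support, so the expectation is a finite sum.\<close>

definition smg_expected_sq_grad ::
  "nat \<Rightarrow> (nat \<Rightarrow> 'a::euclidean_space \<Rightarrow> real) \<Rightarrow> real \<Rightarrow> (nat \<Rightarrow> real) \<Rightarrow> 'a \<Rightarrow> nat \<Rightarrow> real" where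
  "smg_expected_sq_grad n f \<beta> \<eta> w0 T =
     measure_pmf.expectation (pair_pmf (reshuffling_pmf n T) (epoch_pmf \<eta> T))
       (\<lambda>(\<pi>, t). (norm (grad (objective n f) (smg_iterate n f \<beta> \<eta> w0 \<pi> (t - 1))))\<^sup>2)"

definition diminishing_rate :: "nat \<Rightarrow> real \<Rightarrow> real \<Rightarrow> nat \<Rightarrow> real" where
  "diminishing_rate n \<gamma> lam t = \<gamma> * real n powr (1/3) / (real t + lam) powr (1/3)"

definition D_const :: "nat \<Rightarrow> real \<Rightarrow> real \<Rightarrow> real" where
  "D_const n \<beta> \<Theta> = max (5/3) (6 * (5 - 3 * \<beta>) * (\<Theta> + real n) / (real n * (1 - \<beta>)))"

text \<open>The first argument \<open>\<Delta>\<close> stands for the initial optimality gap.\<close>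

definition C3_const :: "real \<Rightarrow> real \<Rightarrow> real \<Rightarrow> real \<Rightarrow> real \<Rightarrow> real \<Rightarrow> real" where
  "C3_const \<Delta> L \<sigma> \<beta> \<gamma> lam =
     4 * \<Delta> / ((1 - \<beta>) * \<gamma>)
     + 12 * \<sigma>\<^sup>2 * (5 - 3 * \<beta>) * L\<^sup>2 * \<gamma>\<^sup>2 / ((1 - \<beta>) * (1 + lam))"

definition C4_const :: "real \<Rightarrow> real \<Rightarrow> real \<Rightarrow> real \<Rightarrow> real" where
  "C4_const L \<sigma> \<beta> \<gamma> = 6 * \<sigma>\<^sup>2 * (5 - 3 * \<beta>) * L\<^sup>2 * \<gamma>\<^sup>2 / (1 - \<beta>)"

definition admissible_params ::
  "nat \<Rightarrow> real \<Rightarrow> real \<Rightarrow> real \<Rightarrow> real \<Rightarrow> real \<Rightarrow> bool" where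
  "admissible_params n L \<Theta> \<beta> \<gamma> lam \<longleftrightarrow>
     0 \<le> \<beta> \<and> \<beta> < 1 \<and> 0 < \<gamma> \<and>
     diminishing_rate n \<gamma> lam 1 \<le> 1 / (L * sqrt (D_const n \<beta> \<Theta>))"

end

theory Submission
  imports Defs
begin

text \<open>Over one epoch the method moves the point by \<open>- h\<close> times \<open>\<beta> *\<^sub>R m + (1 - \<beta>) *\<^sub>R v\<close>, where
  \<open>h\<close> is the learning rate and \<open>m\<close> and \<open>v\<close> are the mean gradients seen in the previous and in the
  current epoch (\<open>m\<close> is zero in the first one). By smoothness, the squared error of \<open>v\<close> as an estimate
  of the gradient of \<open>F\<close> at the start of the current epoch is at most the scaled mean squared drift of
  the inner points from that start, and the squared error of \<open>m\<close> is at most their drift from the end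
  of the previous epoch. In the first epoch it is the squared gradient instead, which the weight
  \<open>\<beta> < 1\<close> makes harmless. The descent lemma therefore shows that \<open>F\<close> decreases by \<open>h / 2\<close> times the
  squared gradient, up to these errors (\<open>epoch_descent\<close>).

  The drifts consist of partial sums of gradients along a random order. For sampling without replacement
  the centred summands are not positively correlated, which bounds the expected square of a partial
  average by the squared gradient plus the variance divided by \<open>n\<close>
  (\<open>expectation_permutation_partial_mean_le\<close>). With the smallness of the learning rate this gives, in
  expectation, drifts that are at most a quarter of \<open>1 - \<beta>\<close> times the squared gradient, plus a
  fourteenth of the previous end drift, plus a term of order \<open>L\<^sup>2 * h\<^sup>2 * \<sigma>\<^sup>2 / n\<close>. A potential consisting
  of \<open>F\<close> and a multiple of the previous end drift then decreases up to that last term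
  (\<open>potential_step\<close>), and summation over the epochs gives \<open>smg_bound\<close>, valid for every nonincreasing
  sequence of small learning rates.

  For the diminishing rate, the sum of the cubes is harmonic and produces the logarithm, and the sum
  of the rates is at least the difference of the powers \<open>2/3\<close>. The rate of convergence follows because
  for \<open>T \<ge> 2\<close> this difference is at least a constant multiple of the power \<open>2/3\<close> of \<open>T\<close>, with a constant
  that depends on \<open>lam\<close> only.\<close>

section \<open>Random permutations\<close>

lemma set_pmf_uniform_permutation:
  assumes "finite S"
  shows "set_pmf (pmf_of_set {p. p permutes S}) = {p. p permutes S}"
  using finite_permutations[OF assms] permutes_id[of S] by (intro set_pmf_of_set) blast+

lemma finite_set_pmf_uniform_permutation:
  "finite S \<Longrightarrow> finite (set_pmf (pmf_of_set {p. p permutes S}))"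
  by (simp add: set_pmf_uniform_permutation finite_permutations)

lemma sum_permutations_eq_of_pairs:
  fixes h :: "'i \<Rightarrow> 'i \<Rightarrow> real"
  assumes "finite S" "j \<in> S" "l \<in> S" "j' \<in> S" "l' \<in> S" "j \<noteq> l" "j' \<noteq> l'"
  shows "(\<Sum>p | p permutes S. h (p j) (p l)) = (\<Sum>p | p permutes S. h (p j') (p l'))"
proof -
  define l1 where "l1 = Transposition.transpose j j' l"
  \<comment> \<open>The first transposition sends \<open>j\<close> to \<open>j'\<close> and \<open>l\<close> to \<open>l1\<close>; the second moves \<open>l1\<close> to \<open>l'\<close> and fixes \<open>j'\<close>.\<close>
  define \<tau> where "\<tau> = Transposition.transpose l1 l' \<circ> Transposition.transpose j j'"
  have l1: "l1 \<in> S" "l1 \<noteq> j'" using assms by (auto simp: l1_def Transposition.transpose_def)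
  have perm: "\<tau> permutes S"
    unfolding \<tau>_def using assms l1 by (intro permutes_compose permutes_swap_id)
  have \<tau>: "\<tau> j = j'" "\<tau> l = l'"
    using l1 assms by (simp_all add: \<tau>_def l1_def[symmetric] transpose_apply_other)
  have "(\<Sum>p | p permutes S. h (p j') (p l')) = (\<Sum>p | p permutes S. h ((p \<circ> \<tau>) j) ((p \<circ> \<tau>) l))"
    using \<tau> by simp
  also have "\<dots> = (\<Sum>p | p permutes S. h (p j) (p l))"
    using sum_permutations_compose_right[OF perm, of "\<lambda>p. h (p j) (p l)"] by simp
  finally show ?thesis ..
qed

lemma sum_permutations_eq_of_points:
  fixes h :: "'i \<Rightarrow> 'b::comm_monoid_add"
  assumes "j \<in> S" "j' \<in> S"
  shows "(\<Sum>p | p permutes S. h (p j)) = (\<Sum>p | p permutes S. h (p j'))"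
proof -
  have perm: "Transposition.transpose j j' permutes S" using assms by (rule permutes_swap_id)
  show ?thesis
    using sum_permutations_compose_right[OF perm, of "\<lambda>p. h (p j')"]
      sum_permutations_compose_right[OF perm, of "\<lambda>p. h (p j)"] by simp
qed

text \<open>Sampling without replacement never makes centred values positively correlated: for fixed \<open>j\<close> the
  correlations with all \<open>l \<in> S\<close> sum to zero, the diagonal one is nonnegative, and by symmetry the
  others agree.\<close>

lemma sum_permutations_pair_nonpos:
  fixes b :: "'i \<Rightarrow> 'a::real_inner"
  assumes S: "finite S" "j \<in> S" "l \<in> S" "j \<noteq> l" and zero: "(\<Sum>i\<in>S. b i) = 0"
  shows "(\<Sum>p | p permutes S. b (p j) \<bullet> b (p l)) \<le> 0"
proof -
  define c where "c l = (\<Sum>p | p permutes S. b (p j) \<bullet> b (p l))" for l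
  have "(\<Sum>l\<in>S. c l) = (\<Sum>p | p permutes S. b (p j) \<bullet> (\<Sum>l\<in>S. b (p l)))"
    unfolding c_def by (subst sum.swap) (simp add: inner_sum_right)
  also have "\<dots> = 0"
    using zero sum.permute[of _ S b] by (intro sum.neutral) (auto simp: o_def)
  finally have "c j + (\<Sum>l\<in>S - {j}. c l) = 0"
    using S by (simp add: sum.remove)
  moreover have "(\<Sum>l'\<in>S - {j}. c l') = (\<Sum>l'\<in>S - {j}. c l)"
    unfolding c_def using S by (intro sum.cong refl sum_permutations_eq_of_pairs) auto
  moreover have "0 \<le> c j" unfolding c_def by (intro sum_nonneg) simp
  ultimately have "real (card (S - {j})) * c l \<le> 0" by simp
  moreover have "0 < card (S - {j})" using S by (subst card_gt_0_iff) blast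
  ultimately show ?thesis by (simp add: mult_le_0_iff c_def del: card_Diff_singleton)
qed

text \<open>Since the off-diagonal correlations are nonpositive, a partial sum has at most the second
  moment that independent sampling would give; the terms outside \<open>A\<close> are added for a bound that does
  not depend on \<open>A\<close>.\<close>

lemma sum_permutations_norm_sq_le:
  fixes b :: "'i \<Rightarrow> 'a::real_inner"
  assumes S: "finite S" "A \<subseteq> S" and zero: "(\<Sum>i\<in>S. b i) = 0"
  shows "(\<Sum>p | p permutes S. (norm (\<Sum>j\<in>A. b (p j)))\<^sup>2)
           \<le> (\<Sum>p | p permutes S. (\<Sum>i\<in>S. (norm (b i))\<^sup>2))"
proof -
  have fA: "finite A" using S finite_subset by blast
  define c where "c j l = (\<Sum>p | p permutes S. b (p j) \<bullet> b (p l))" for j l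
  have "(\<Sum>p | p permutes S. (norm (\<Sum>j\<in>A. b (p j)))\<^sup>2)
      = (\<Sum>p | p permutes S. \<Sum>j\<in>A. \<Sum>l\<in>A. b (p j) \<bullet> b (p l))"
    by (simp only: power2_norm_eq_inner inner_sum_left) (simp only: inner_sum_right)
  also have "\<dots> = (\<Sum>j\<in>A. \<Sum>l\<in>A. c j l)"
    unfolding c_def by (subst sum.swap, intro sum.cong refl, subst sum.swap, simp)
  also have "\<dots> \<le> (\<Sum>j\<in>A. c j j)"
  proof (intro sum_mono)
    fix j assume j: "j \<in> A"
    have "(\<Sum>l\<in>A - {j}. c j l) \<le> 0"
      unfolding c_def using S j
      by (intro sum_nonpos sum_permutations_pair_nonpos zero) auto
    then show "(\<Sum>l\<in>A. c j l) \<le> c j j"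
      using fA j by (simp add: sum.remove)
  qed
  also have "\<dots> \<le> (\<Sum>j\<in>S. c j j)"
    unfolding c_def using S by (intro sum_mono2) (auto intro!: sum_nonneg)
  also have "\<dots> = (\<Sum>p | p permutes S. \<Sum>j\<in>S. (norm (b (p j)))\<^sup>2)"
    unfolding c_def by (subst sum.swap) (simp add: power2_norm_eq_inner)
  also have "\<dots> = (\<Sum>p | p permutes S. (\<Sum>i\<in>S. (norm (b i))\<^sup>2))"
  proof (rule sum.cong[OF refl])
    fix p assume "p \<in> {p. p permutes S}"
    then show "(\<Sum>j\<in>S. (norm (b (p j)))\<^sup>2) = (\<Sum>i\<in>S. (norm (b i))\<^sup>2)"
      using sum.permute[of p S "\<lambda>i. (norm (b i))\<^sup>2"] by (simp add: o_def)
  qed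
  finally show ?thesis .
qed

text \<open>A partial sum along a random order, divided by the full cardinality, has second moment at
  most the squared mean plus the variance divided by the cardinality. This factor \<open>1 / N\<close> is what
  reshuffling gains over an arbitrary order.\<close>

lemma expectation_permutation_partial_mean_le:
  fixes a :: "'i \<Rightarrow> 'a::real_inner"
  assumes S: "finite S" "A \<subseteq> S"
  defines "N \<equiv> real (card S)"
  defines "\<mu> \<equiv> (1 / N) *\<^sub>R (\<Sum>i\<in>S. a i)"
  shows "measure_pmf.expectation (pmf_of_set {p. p permutes S})
           (\<lambda>p. (norm ((1 / N) *\<^sub>R (\<Sum>j\<in>A. a (p j))))\<^sup>2)
         \<le> (norm \<mu>)\<^sup>2 + (1 / N) * ((1 / N) * (\<Sum>i\<in>S. (norm (a i - \<mu>))\<^sup>2))"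
proof (cases "S = {}")
  case True
  with S show ?thesis by simp
next
  case False
  define P where "P = {p. p permutes S}"
  have P: "finite P" "P \<noteq> {}"
    unfolding P_def using S finite_permutations permutes_id by blast+
  have N: "0 < N" using False S by (simp add: N_def card_gt_0_iff)
  define b where "b i = a i - \<mu>" for i
  define k where "k = real (card A)"
  have k: "0 \<le> k" "k \<le> N" using S by (auto simp: k_def N_def card_mono)
  have zero: "(\<Sum>i\<in>S. b i) = 0"
    using N by (simp add: b_def sum_subtractf \<mu>_def N_def sum_constant_scaleR)
  \<comment> \<open>The sum over \<open>p\<close> does not depend on \<open>j\<close>, and its total over all \<open>j\<close> vanishes.\<close>
  have point: "(\<Sum>p\<in>P. b (p j)) = 0" if "j \<in> S" for j
  proof -
    have "N *\<^sub>R (\<Sum>p\<in>P. b (p j)) = (\<Sum>l\<in>S. \<Sum>p\<in>P. b (p j))"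
      by (simp add: N_def sum_constant_scaleR)
    also have "\<dots> = (\<Sum>l\<in>S. \<Sum>p\<in>P. b (p l))"
      unfolding P_def using that by (intro sum.cong refl sum_permutations_eq_of_points)
    also have "\<dots> = (\<Sum>p\<in>P. \<Sum>l\<in>S. b (p l))" by (rule sum.swap)
    also have "\<dots> = 0"
      using zero sum.permute[of _ S b] by (intro sum.neutral) (auto simp: o_def P_def)
    finally show ?thesis using N by simp
  qed
  define B where "B p = (\<Sum>j\<in>A. b (p j))" for p
  have split: "(\<Sum>j\<in>A. a (p j)) = k *\<^sub>R \<mu> + B p" for p
    by (simp add: B_def b_def sum_subtractf k_def sum_constant_scaleR)
  have "(\<Sum>p\<in>P. \<mu> \<bullet> B p) = \<mu> \<bullet> (\<Sum>j\<in>A. \<Sum>p\<in>P. b (p j))"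
    unfolding B_def by (subst sum.swap) (simp add: inner_sum_right)
  also have "\<dots> = 0" using S point by (simp add: subset_eq)
  finally have cross: "(\<Sum>p\<in>P. \<mu> \<bullet> B p) = 0" .
  have "(\<Sum>p\<in>P. (norm (\<Sum>j\<in>A. a (p j)))\<^sup>2)
      = (\<Sum>p\<in>P. k\<^sup>2 * (norm \<mu>)\<^sup>2 + 2 * k * (\<mu> \<bullet> B p) + (norm (B p))\<^sup>2)"
    unfolding split
    by (intro sum.cong refl)
       (simp add: power2_norm_eq_inner inner_add_left inner_add_right inner_commute,
        simp add: power2_eq_square)
  also have "\<dots> = real (card P) * (k\<^sup>2 * (norm \<mu>)\<^sup>2) + (\<Sum>p\<in>P. (norm (B p))\<^sup>2)"
    by (simp add: sum.distrib sum_distrib_left[symmetric] cross)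
  also have "\<dots> \<le> real (card P) * (N\<^sup>2 * (norm \<mu>)\<^sup>2)
      + real (card P) * (\<Sum>i\<in>S. (norm (b i))\<^sup>2)"
  proof (rule add_mono)
    show "real (card P) * (k\<^sup>2 * (norm \<mu>)\<^sup>2) \<le> real (card P) * (N\<^sup>2 * (norm \<mu>)\<^sup>2)"
      using k by (intro mult_left_mono mult_right_mono power_mono) auto
    show "(\<Sum>p\<in>P. (norm (B p))\<^sup>2) \<le> real (card P) * (\<Sum>i\<in>S. (norm (b i))\<^sup>2)"
      using sum_permutations_norm_sq_le[OF S zero] by (simp add: B_def P_def)
  qed
  finally have main: "(\<Sum>p\<in>P. (norm (\<Sum>j\<in>A. a (p j)))\<^sup>2)
      \<le> real (card P) * (N\<^sup>2 * (norm \<mu>)\<^sup>2 + (\<Sum>i\<in>S. (norm (b i))\<^sup>2))"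
    by (simp add: distrib_left)
  have cP: "0 < real (card P)" using P by (simp add: card_gt_0_iff)
  have "measure_pmf.expectation (pmf_of_set P) (\<lambda>p. (norm ((1 / N) *\<^sub>R (\<Sum>j\<in>A. a (p j))))\<^sup>2)
      = (\<Sum>p\<in>P. (norm (\<Sum>j\<in>A. a (p j)))\<^sup>2) / (N\<^sup>2 * real (card P))"
    using P N
    by (simp add: integral_pmf_of_set power_divide sum_divide_distrib[symmetric])
  also have "\<dots> \<le> (N\<^sup>2 * (norm \<mu>)\<^sup>2 + (\<Sum>i\<in>S. (norm (b i))\<^sup>2)) / N\<^sup>2"
    using main N cP by (simp add: field_simps)
  also have "\<dots> = (norm \<mu>)\<^sup>2 + (1 / N) * ((1 / N) * (\<Sum>i\<in>S. (norm (a i - \<mu>))\<^sup>2))"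
    using N by (simp add: b_def field_simps power2_eq_square)
  finally show ?thesis unfolding P_def .
qed

text \<open>Drawing one coordinate of an independent family afresh does not change its law. It is used
  to average over the permutation of one epoch while the earlier ones stay fixed.\<close>

lemma expectation_Pi_pmf_resample:
  fixes h :: "('i \<Rightarrow> 'b) \<Rightarrow> real"
  assumes "finite I" "t \<in> I" and fin: "\<And>i. i \<in> I \<Longrightarrow> finite (set_pmf (P i))"
  shows "measure_pmf.expectation (Pi_pmf I d P) h
       = measure_pmf.expectation (Pi_pmf I d P)
           (\<lambda>\<pi>. measure_pmf.expectation (P t) (\<lambda>y. h (\<pi>(t := y))))"
proof -
  define A where "A = I - {t}"
  have A: "finite A" "t \<notin> A" "I = insert t A" using assms by (auto simp: A_def)
  have fin_Pi: "finite (set_pmf (Pi_pmf I d P))"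
    using assms by (simp add: set_Pi_pmf finite_PiE_dflt)
  have 1: "Pi_pmf I d P = P t \<bind> (\<lambda>y. Pi_pmf A d P \<bind> (\<lambda>f. return_pmf (f(t := y))))"
    unfolding A(3) by (rule Pi_pmf_insert'[OF A(1,2)])
  have upd: "fun_upd (f(t := y)) t = fun_upd f t" for f :: "'i \<Rightarrow> 'b" and y
    by (intro ext) simp
  have "Pi_pmf I d P \<bind> (\<lambda>\<pi>. map_pmf (\<lambda>y. \<pi>(t := y)) (P t))
      = Pi_pmf A d P \<bind> (\<lambda>f. map_pmf (\<lambda>y. f(t := y)) (P t))"
    unfolding 1 by (simp add: upd bind_assoc_pmf bind_return_pmf bind_pmf_const)
  also have "\<dots> = Pi_pmf I d P"
    unfolding 1 map_pmf_def by (rule bind_commute_pmf)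
  finally have 2: "Pi_pmf I d P = Pi_pmf I d P \<bind> (\<lambda>\<pi>. map_pmf (\<lambda>y. \<pi>(t := y)) (P t))" ..
  have "measure_pmf.expectation (Pi_pmf I d P) h
      = measure_pmf.expectation (Pi_pmf I d P \<bind> (\<lambda>\<pi>. map_pmf (\<lambda>y. \<pi>(t := y)) (P t))) h"
    using 2 by simp
  also have "\<dots> = (\<Sum>\<pi>\<in>set_pmf (Pi_pmf I d P). pmf (Pi_pmf I d P) \<pi> *\<^sub>R
       measure_pmf.expectation (map_pmf (\<lambda>y. \<pi>(t := y)) (P t)) h)"
    using fin_Pi fin assms by (intro pmf_expectation_bind) auto
  also have "\<dots> = measure_pmf.expectation (Pi_pmf I d P)
       (\<lambda>\<pi>. measure_pmf.expectation (P t) (\<lambda>y. h (\<pi>(t := y))))"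
    using fin_Pi by (subst integral_measure_pmf[of "set_pmf (Pi_pmf I d P)"]) auto
  finally show ?thesis .
qed

section \<open>Norm inequalities and smooth functions\<close>

lemma norm_sq_partial_mean_le:
  fixes d :: "nat \<Rightarrow> 'a::real_inner"
  assumes "A \<subseteq> {..<n}"
  shows "(norm ((1 / real n) *\<^sub>R (\<Sum>j\<in>A. d j)))\<^sup>2 \<le> (1 / real n) * (\<Sum>j<n. (norm (d j))\<^sup>2)"
proof (cases "n = 0")
  case False
  have card: "real (card A) \<le> real n"
    using card_mono[OF finite_lessThan assms] by simp
  have "(norm (\<Sum>j\<in>A. d j))\<^sup>2 \<le> (\<Sum>j\<in>A. norm (d j))\<^sup>2"
    by (intro power_mono norm_sum) simp
  also have "\<dots> \<le> (\<Sum>j\<in>A. (norm (d j))\<^sup>2) * card A"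
    by (rule sum_squared_le_sum_of_squares)
  also have "\<dots> \<le> (\<Sum>j<n. (norm (d j))\<^sup>2) * n"
    using assms card by (intro mult_mono sum_mono2) (auto intro: sum_nonneg)
  finally show ?thesis
    using False by (simp add: power_divide field_simps power2_eq_square)
qed simp

lemma norm_sq_convex_combination_le:
  fixes x y :: "'a::real_inner"
  assumes "0 \<le> \<beta>" "\<beta> \<le> 1"
  shows "(norm (\<beta> *\<^sub>R x + (1 - \<beta>) *\<^sub>R y))\<^sup>2 \<le> \<beta> * (norm x)\<^sup>2 + (1 - \<beta>) * (norm y)\<^sup>2"
proof -
  have "\<beta> * (norm x)\<^sup>2 + (1 - \<beta>) * (norm y)\<^sup>2 - (norm (\<beta> *\<^sub>R x + (1 - \<beta>) *\<^sub>R y))\<^sup>2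
      = \<beta> * (1 - \<beta>) * (norm (x - y))\<^sup>2"
    unfolding power2_norm_eq_inner
    by (simp add: inner_add_left inner_add_right inner_diff_left inner_diff_right
        inner_commute[of y x]) algebra
  moreover have "0 \<le> \<beta> * (1 - \<beta>) * (norm (x - y))\<^sup>2" using assms by simp
  ultimately show ?thesis by linarith
qed

lemma norm_add_sq_le:
  fixes x y :: "'a::real_inner"
  shows "(norm (x + y))\<^sup>2 \<le> 2 * (norm x)\<^sup>2 + 2 * (norm y)\<^sup>2"
proof -
  have "2 * (norm x)\<^sup>2 + 2 * (norm y)\<^sup>2 - (norm (x + y))\<^sup>2 = (norm (x - y))\<^sup>2"
    unfolding power2_norm_eq_inner
    by (simp add: inner_add_left inner_add_right inner_diff_left inner_diff_right
        inner_commute[of y x])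
  then show ?thesis by (smt (verit) zero_le_power2)
qed

lemma descent_lemma:
  fixes h :: "'a::real_inner \<Rightarrow> real"
  assumes deriv: "\<And>w. GDERIV h w :> g w"
    and lip: "\<And>w w'. norm (g w - g w') \<le> L * norm (w - w')"
  shows "h y \<le> h x + g x \<bullet> (y - x) + L / 2 * (norm (y - x))\<^sup>2"
proof -
  define d where "d = y - x"
  define \<phi> where "\<phi> t = h (x + t *\<^sub>R d) - t * (g x \<bullet> d) - L / 2 * (t\<^sup>2 * (norm d)\<^sup>2)" for t
  define \<phi>' where "\<phi>' t = (g (x + t *\<^sub>R d) - g x) \<bullet> d - L * t * (norm d)\<^sup>2" for t
  \<comment> \<open>The function along the segment minus the claimed upper bound is nonincreasing.\<close>
  have line: "((\<lambda>t. h (x + t *\<^sub>R d)) has_real_derivative g (x + t *\<^sub>R d) \<bullet> d) (at t)" for t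
  proof -
    have "((\<lambda>t. x + t *\<^sub>R d) has_derivative (\<lambda>s. s *\<^sub>R d)) (at t)"
      by (auto intro!: derivative_eq_intros)
    from has_derivative_compose[OF this deriv[of "x + t *\<^sub>R d", unfolded gderiv_def]]
    show ?thesis
      unfolding has_field_derivative_def
      by (rule has_derivative_eq_rhs) (simp add: fun_eq_iff inner_commute mult.commute)
  qed
  have "\<phi> 1 \<le> \<phi> 0"
  proof (rule DERIV_nonpos_imp_nonincreasing[of 0 1])
    fix t :: real assume t: "0 \<le> t" "t \<le> 1"
    have "(\<phi> has_real_derivative \<phi>' t) (at t)"
      unfolding \<phi>_def \<phi>'_def
      by (auto intro!: derivative_eq_intros line simp: inner_diff_left)
    moreover have "(g (x + t *\<^sub>R d) - g x) \<bullet> d \<le> L * t * (norm d)\<^sup>2"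
    proof -
      have "(g (x + t *\<^sub>R d) - g x) \<bullet> d \<le> norm (g (x + t *\<^sub>R d) - g x) * norm d"
        by (rule norm_cauchy_schwarz)
      also have "\<dots> \<le> (L * norm (x + t *\<^sub>R d - x)) * norm d"
        by (intro mult_right_mono lip) simp
      finally show ?thesis using t by (simp add: power2_eq_square)
    qed
    ultimately show "\<exists>D. (\<phi> has_real_derivative D) (at t) \<and> D \<le> 0"
      unfolding \<phi>'_def by (intro exI[of _ "\<phi>' t"]) (auto simp: \<phi>'_def)
  qed simp
  then show ?thesis by (simp add: \<phi>_def d_def)
qed

section \<open>The finite-sum objective\<close>

text \<open>The finite-sum problem: \<open>n\<close> differentiable components with \<open>L\<close>-Lipschitz gradients, an
  average bounded below, and component gradients whose variance is at most
  \<open>\<Theta> * (norm (grad F w))\<^sup>2 + \<sigma>\<^sup>2\<close>.\<close>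

locale finite_sum =
  fixes n :: nat and f :: "nat \<Rightarrow> 'a::euclidean_space \<Rightarrow> real" and L \<Theta> \<sigma> :: real
  assumes problem: "finite_sum_problem n f L \<Theta> \<sigma>"
begin

abbreviation F where "F \<equiv> objective n f"

lemma n_pos: "0 < real n" and L_pos: "0 < L" and Theta_nonneg: "0 \<le> \<Theta>"
  and grad_lipschitz: "i \<in> {1..n} \<Longrightarrow> norm (grad (f i) w - grad (f i) w') \<le> L * norm (w - w')"
  and variance_bound: "(1 / real n) * (\<Sum>i=1..n. (norm (grad (f i) w - grad F w))\<^sup>2)
            \<le> \<Theta> * (norm (grad F w))\<^sup>2 + \<sigma>\<^sup>2"
  using problem by (auto simp: finite_sum_problem_def)

lemma objective_inf_le: "objective_inf n f \<le> F w"
  unfolding objective_inf_def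
  using problem by (intro cINF_lower) (auto simp: finite_sum_problem_def)

lemma GDERIV_objective: "GDERIV F w :> (1 / real n) *\<^sub>R (\<Sum>i=1..n. grad (f i) w)"
proof -
  have "(f i has_derivative (\<lambda>x. x \<bullet> grad (f i) w)) (at w)" if "i \<in> {1..n}" for i
    using GDERIV_grad[of "f i" w] problem that
    by (auto simp: finite_sum_problem_def gderiv_def)
  then have "((\<lambda>w. (1 / real n) * (\<Sum>i=1..n. f i w)) has_derivative
      (\<lambda>x. (1 / real n) * (\<Sum>i=1..n. x \<bullet> grad (f i) w))) (at w)"
    by (intro has_derivative_mult_right has_derivative_sum) auto
  then show ?thesis
    unfolding gderiv_def objective_def[abs_def]
    by (simp add: inner_sum_right)
qed

lemma grad_objective: "grad F w = (1 / real n) *\<^sub>R (\<Sum>i=1..n. grad (f i) w)"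
proof -
  let ?D = "(1 / real n) *\<^sub>R (\<Sum>i=1..n. grad (f i) w)"
  have "F differentiable (at w)"
    using GDERIV_objective by (auto simp: gderiv_def differentiable_def)
  then have "GDERIV F w :> grad F w" by (rule GDERIV_grad)
  with GDERIV_objective have "(\<lambda>x. x \<bullet> grad F w) = (\<lambda>x. x \<bullet> ?D)"
    unfolding gderiv_def by (rule has_derivative_unique[rotated])
  then have "x \<bullet> grad F w = x \<bullet> ?D" for x by metis
  then show ?thesis by (metis vector_eq_ldot)
qed

lemma norm_sq_mean_grad_diff_le:
  assumes perm: "p permutes {1..n}" and A: "A \<subseteq> {..<n}"
  shows "(norm ((1 / real n) *\<^sub>R (\<Sum>j\<in>A. grad (f (p (Suc j))) (u j) - grad (f (p (Suc j))) w)))\<^sup>2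
           \<le> L\<^sup>2 * ((1 / real n) * (\<Sum>j<n. (norm (u j - w))\<^sup>2))"
proof -
  have "(norm ((1 / real n) *\<^sub>R (\<Sum>j\<in>A. grad (f (p (Suc j))) (u j) - grad (f (p (Suc j))) w)))\<^sup>2
      \<le> (1 / real n) * (\<Sum>j<n. (norm (grad (f (p (Suc j))) (u j) - grad (f (p (Suc j))) w))\<^sup>2)"
    by (rule norm_sq_partial_mean_le[OF A])
  also have "\<dots> \<le> (1 / real n) * (\<Sum>j<n. (L * norm (u j - w))\<^sup>2)"
    using permutes_in_image[OF perm]
    by (intro mult_left_mono sum_mono power_mono grad_lipschitz) auto
  finally show ?thesis
    by (simp add: power_mult_distrib sum_distrib_left algebra_simps)
qed

lemma mean_permuted_grad:
  assumes "p permutes {1..n}"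
  shows "(1 / real n) *\<^sub>R (\<Sum>j<n. grad (f (p (Suc j))) w) = grad F w"
proof -
  have "(\<Sum>j<n. grad (f (p (Suc j))) w) = (\<Sum>j=1..n. grad (f (p j)) w)"
    by (simp add: sum.atLeast1_atMost_eq)
  also have "\<dots> = (\<Sum>i=1..n. grad (f i) w)"
    using sum.permute[OF assms, of "\<lambda>i. grad (f i) w"] by (simp add: o_def)
  finally show ?thesis by (simp add: grad_objective)
qed

lemma objective_descent:
  "F y \<le> F x + grad F x \<bullet> (y - x) + L / 2 * (norm (y - x))\<^sup>2"
proof (rule descent_lemma)
  show "GDERIV F w :> grad F w" for w
    using GDERIV_objective by (simp add: grad_objective)
  show "norm (grad F w - grad F w') \<le> L * norm (w - w')" for w w'
  proof -
    have "norm (grad F w - grad F w') = (1 / real n) * norm (\<Sum>i=1..n. grad (f i) w - grad (f i) w')"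
      by (simp add: grad_objective sum_subtractf scaleR_diff_right[symmetric])
    also have "\<dots> \<le> (1 / real n) * (\<Sum>i=1..n. L * norm (w - w'))"
      by (intro mult_left_mono order_trans[OF norm_sum] sum_mono grad_lipschitz) auto
    also have "\<dots> = L * norm (w - w')" using n_pos by simp
    finally show ?thesis .
  qed
qed

end

section \<open>One epoch\<close>

context finite_sum
begin

text \<open>The point \<open>w\<^sub>i\<close> within an epoch that starts at \<open>w\<close> with momentum \<open>m\<close>, learning rate \<open>h\<close> and
  permutation \<open>p\<close>.\<close>

definition inner_iterate ::
  "real \<Rightarrow> real \<Rightarrow> (nat \<Rightarrow> nat) \<Rightarrow> 'a \<Rightarrow> 'a \<Rightarrow> nat \<Rightarrow> 'a" where
  "inner_iterate \<beta> h p w m i = fst (smg_inner n f \<beta> h p w m i)"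

text \<open>The component gradient used in the step from \<open>w\<^sub>j\<close> to \<open>w\<^sub>j\<^sub>+\<^sub>1\<close>. Steps are counted from zero and
  components from one, hence \<open>p (Suc j)\<close>.\<close>

definition inner_grad ::
  "real \<Rightarrow> real \<Rightarrow> (nat \<Rightarrow> nat) \<Rightarrow> 'a \<Rightarrow> 'a \<Rightarrow> nat \<Rightarrow> 'a" where
  "inner_grad \<beta> h p w m j = grad (f (p (Suc j))) (inner_iterate \<beta> h p w m j)"

text \<open>The average of the gradients seen in the epoch, which becomes the momentum of the next one.\<close>

definition epoch_mean :: "real \<Rightarrow> real \<Rightarrow> (nat \<Rightarrow> nat) \<Rightarrow> 'a \<Rightarrow> 'a \<Rightarrow> 'a" where
  "epoch_mean \<beta> h p w m = (1 / real n) *\<^sub>R (\<Sum>j<n. inner_grad \<beta> h p w m j)"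

text \<open>The mean squared distance of the inner points from the first, respectively the last, point of
  the epoch. The factor \<open>L\<^sup>2\<close> turns it into a bound for the squared error of a gradient average.\<close>

definition start_drift :: "real \<Rightarrow> real \<Rightarrow> (nat \<Rightarrow> nat) \<Rightarrow> 'a \<Rightarrow> 'a \<Rightarrow> real" where
  "start_drift \<beta> h p w m =
     L\<^sup>2 * ((1 / real n) * (\<Sum>i<n. (norm (inner_iterate \<beta> h p w m i - w))\<^sup>2))"

definition end_drift :: "real \<Rightarrow> real \<Rightarrow> (nat \<Rightarrow> nat) \<Rightarrow> 'a \<Rightarrow> 'a \<Rightarrow> real" where
  "end_drift \<beta> h p w m =
     L\<^sup>2 * ((1 / real n) *
       (\<Sum>i<n. (norm (inner_iterate \<beta> h p w m i - inner_iterate \<beta> h p w m n))\<^sup>2))"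

text \<open>The squared norm of the partial gradient average over the steps in \<open>A\<close>, with all gradients
  taken at the starting point \<open>w\<close>. Given \<open>w\<close>, only the permutation is random here.\<close>

definition partial_mean_sq :: "(nat \<Rightarrow> nat) \<Rightarrow> nat set \<Rightarrow> 'a \<Rightarrow> real" where
  "partial_mean_sq p A w = (norm ((1 / real n) *\<^sub>R (\<Sum>j\<in>A. grad (f (p (Suc j))) w)))\<^sup>2"

lemma start_drift_nonneg: "0 \<le> start_drift \<beta> h p w m"
  unfolding start_drift_def by (intro mult_nonneg_nonneg sum_nonneg) auto

lemma end_drift_nonneg: "0 \<le> end_drift \<beta> h p w m"
  unfolding end_drift_def by (intro mult_nonneg_nonneg sum_nonneg) auto

lemma inner_iterate_eq:
  "inner_iterate \<beta> h p w m i
     = w - (h / real n) *\<^sub>R (\<Sum>j<i. \<beta> *\<^sub>R m + (1 - \<beta>) *\<^sub>R inner_grad \<beta> h p w m j)"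
proof (induction i)
  case 0
  then show ?case by (simp add: inner_iterate_def)
next
  case (Suc i)
  have "inner_iterate \<beta> h p w m (Suc i) = inner_iterate \<beta> h p w m i
      - (h / real n) *\<^sub>R (\<beta> *\<^sub>R m + (1 - \<beta>) *\<^sub>R inner_grad \<beta> h p w m i)"
    by (simp add: inner_iterate_def inner_grad_def Let_def case_prod_beta)
  then show ?case using Suc by (simp add: scaleR_add_right)
qed

lemma smg_inner_mean:
  "snd (snd (smg_inner n f \<beta> h p w m i)) = (1 / real n) *\<^sub>R (\<Sum>j<i. inner_grad \<beta> h p w m j)"
  by (induction i)
     (simp_all add: inner_grad_def inner_iterate_def Let_def case_prod_beta scaleR_add_right)

lemma epoch_step:
  "inner_iterate \<beta> h p w m n = w - h *\<^sub>R (\<beta> *\<^sub>R m + (1 - \<beta>) *\<^sub>R epoch_mean \<beta> h p w m)"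
  unfolding inner_iterate_eq[of \<beta> h p w m n] epoch_mean_def
  using n_pos
  by (simp add: sum.distrib scaleR_sum_right[symmetric] sum_constant_scaleR scaleR_add_right)

lemma epoch_mean_near_start:
  assumes "p permutes {1..n}"
  shows "(norm (grad F w - epoch_mean \<beta> h p w m))\<^sup>2 \<le> start_drift \<beta> h p w m"
  using norm_sq_mean_grad_diff_le[OF assms subset_refl, of "inner_iterate \<beta> h p w m" w]
  by (simp add: start_drift_def epoch_mean_def inner_grad_def mean_permuted_grad[OF assms, symmetric]
      sum_subtractf scaleR_diff_right norm_minus_commute)

lemma epoch_mean_near_end:
  assumes "p permutes {1..n}"
  shows "(norm (grad F (inner_iterate \<beta> h p w m n) - epoch_mean \<beta> h p w m))\<^sup>2
           \<le> end_drift \<beta> h p w m"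
  using norm_sq_mean_grad_diff_le[OF assms subset_refl, of "inner_iterate \<beta> h p w m"
      "inner_iterate \<beta> h p w m n"]
  by (simp add: end_drift_def epoch_mean_def inner_grad_def mean_permuted_grad[OF assms, symmetric]
      sum_subtractf scaleR_diff_right norm_minus_commute)

text \<open>Any group of steps of an epoch moves the point by a convex combination of the momentum and a
  partial gradient average; the latter is compared with the gradients at the starting point.\<close>

lemma partial_step_norm_sq_le:
  assumes perm: "p permutes {1..n}" and A: "A \<subseteq> {..<n}" and \<beta>: "0 \<le> \<beta>" "\<beta> \<le> 1"
  shows "(norm ((h / real n) *\<^sub>R (\<Sum>j\<in>A. \<beta> *\<^sub>R m + (1 - \<beta>) *\<^sub>R inner_grad \<beta> h p w m j)))\<^sup>2
       \<le> h\<^sup>2 * (\<beta> * (norm m)\<^sup>2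
              + 2 * (1 - \<beta>) * (start_drift \<beta> h p w m + partial_mean_sq p A w))"
proof -
  define k where "k = real (card A) / real n"
  have k: "0 \<le> k" "k \<le> 1"
    using card_mono[OF finite_lessThan A] n_pos by (auto simp: k_def)
  define G where "G = (1 / real n) *\<^sub>R (\<Sum>j\<in>A. inner_grad \<beta> h p w m j)"
  have "G = (1 / real n) *\<^sub>R (\<Sum>j\<in>A. inner_grad \<beta> h p w m j - grad (f (p (Suc j))) w)
      + (1 / real n) *\<^sub>R (\<Sum>j\<in>A. grad (f (p (Suc j))) w)"
    by (simp add: G_def sum_subtractf scaleR_diff_right)
  then have "(norm G)\<^sup>2
      \<le> 2 * (norm ((1 / real n) *\<^sub>R (\<Sum>j\<in>A. inner_grad \<beta> h p w m j - grad (f (p (Suc j))) w)))\<^sup>2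
        + 2 * partial_mean_sq p A w"
    unfolding partial_mean_sq_def by (metis norm_add_sq_le)
  also have "\<dots> \<le> 2 * start_drift \<beta> h p w m + 2 * partial_mean_sq p A w"
    using norm_sq_mean_grad_diff_le[OF perm A, of "inner_iterate \<beta> h p w m" w]
    by (simp add: start_drift_def inner_grad_def)
  finally have G: "(norm G)\<^sup>2 \<le> 2 * (start_drift \<beta> h p w m + partial_mean_sq p A w)" by simp
  have "(norm (k *\<^sub>R m))\<^sup>2 \<le> (norm m)\<^sup>2"
    using k by (intro power_mono) (auto intro: mult_left_le_one_le)
  then have "\<beta> * (norm (k *\<^sub>R m))\<^sup>2 + (1 - \<beta>) * (norm G)\<^sup>2
      \<le> \<beta> * (norm m)\<^sup>2 + (1 - \<beta>) * (2 * (start_drift \<beta> h p w m + partial_mean_sq p A w))"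
    using \<beta> G by (intro add_mono mult_left_mono) auto
  then have bound: "(norm (\<beta> *\<^sub>R (k *\<^sub>R m) + (1 - \<beta>) *\<^sub>R G))\<^sup>2
      \<le> \<beta> * (norm m)\<^sup>2 + 2 * (1 - \<beta>) * (start_drift \<beta> h p w m + partial_mean_sq p A w)"
    using norm_sq_convex_combination_le[OF \<beta>, of "k *\<^sub>R m" G] by (simp only: mult_ac)
  have "(h / real n) *\<^sub>R (\<Sum>j\<in>A. \<beta> *\<^sub>R m + (1 - \<beta>) *\<^sub>R inner_grad \<beta> h p w m j)
      = h *\<^sub>R (\<beta> *\<^sub>R (k *\<^sub>R m) + (1 - \<beta>) *\<^sub>R G)"
    by (simp add: G_def k_def sum.distrib scaleR_sum_right[symmetric] sum_constant_scaleR
        scaleR_add_right mult_ac)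
  then have "(norm ((h / real n) *\<^sub>R (\<Sum>j\<in>A. \<beta> *\<^sub>R m + (1 - \<beta>) *\<^sub>R inner_grad \<beta> h p w m j)))\<^sup>2
      = h\<^sup>2 * (norm (\<beta> *\<^sub>R (k *\<^sub>R m) + (1 - \<beta>) *\<^sub>R G))\<^sup>2"
    by (simp only: norm_scaleR power_mult_distrib power2_abs)
  then show ?thesis using bound by (simp add: mult_left_mono)
qed

lemma mean_sq_le:
  assumes bound: "\<And>i. i < n \<Longrightarrow> (norm (u i))\<^sup>2 \<le> h\<^sup>2 * (a + c * (d + y i))"
  shows "L\<^sup>2 * ((1 / real n) * (\<Sum>i<n. (norm (u i))\<^sup>2))
           \<le> L\<^sup>2 * h\<^sup>2 * (a + c * (d + (1 / real n) * (\<Sum>i<n. y i)))"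
proof -
  have "(1 / real n) * (\<Sum>i<n. (norm (u i))\<^sup>2)
      \<le> (1 / real n) * (\<Sum>i<n. h\<^sup>2 * (a + c * (d + y i)))"
    by (intro mult_left_mono sum_mono bound) auto
  also have "\<dots> = h\<^sup>2 * (a + c * (d + (1 / real n) * (\<Sum>i<n. y i)))"
    using n_pos by (simp add: sum.distrib sum_distrib_left[symmetric] sum_distrib_right[symmetric] field_simps)
  finally show ?thesis using mult_left_mono[OF _ zero_le_power2[of L]] by (simp only: mult.assoc)
qed

text \<open>The drift occurs on both sides; as \<open>L * h\<close> is small, this can later be solved for the drift.\<close>

lemma start_drift_le:
  assumes perm: "p permutes {1..n}" and \<beta>: "0 \<le> \<beta>" "\<beta> \<le> 1"
  shows "start_drift \<beta> h p w m \<le> L\<^sup>2 * h\<^sup>2 * (\<beta> * (norm m)\<^sup>2 + 2 * (1 - \<beta>) *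
           (start_drift \<beta> h p w m + (1 / real n) * (\<Sum>i<n. partial_mean_sq p {..<i} w)))"
proof -
  have "(norm (inner_iterate \<beta> h p w m i - w))\<^sup>2 \<le> h\<^sup>2 * (\<beta> * (norm m)\<^sup>2 + 2 * (1 - \<beta>) *
      (start_drift \<beta> h p w m + partial_mean_sq p {..<i} w))" if "i < n" for i
  proof -
    have "inner_iterate \<beta> h p w m i - w = - ((h / real n) *\<^sub>R
        (\<Sum>j<i. \<beta> *\<^sub>R m + (1 - \<beta>) *\<^sub>R inner_grad \<beta> h p w m j))"
      by (subst inner_iterate_eq) simp
    then show ?thesis
      using partial_step_norm_sq_le[OF perm _ \<beta>, of "{..<i}" h m w] that
      by (simp only: norm_minus_cancel) auto
  qed
  from mean_sq_le[of "\<lambda>i. inner_iterate \<beta> h p w m i - w", OF this]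
  show ?thesis unfolding start_drift_def[symmetric] .
qed

text \<open>The last point depends on the whole permutation, so the gradients are still compared with
  those at the starting point, and the steps from \<open>i\<close> on are summed.\<close>

lemma end_drift_le:
  assumes perm: "p permutes {1..n}" and \<beta>: "0 \<le> \<beta>" "\<beta> \<le> 1"
  shows "end_drift \<beta> h p w m \<le> L\<^sup>2 * h\<^sup>2 * (\<beta> * (norm m)\<^sup>2 + 2 * (1 - \<beta>) *
           (start_drift \<beta> h p w m + (1 / real n) * (\<Sum>i<n. partial_mean_sq p {i..<n} w)))"
proof -
  have "(norm (inner_iterate \<beta> h p w m i - inner_iterate \<beta> h p w m n))\<^sup>2
      \<le> h\<^sup>2 * (\<beta> * (norm m)\<^sup>2 + 2 * (1 - \<beta>) *
        (start_drift \<beta> h p w m + partial_mean_sq p {i..<n} w))" if "i < n" for i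
  proof -
    let ?s = "\<lambda>j. \<beta> *\<^sub>R m + (1 - \<beta>) *\<^sub>R inner_grad \<beta> h p w m j"
    have "{..<n} = {..<i} \<union> {i..<n}" using that by auto
    moreover have "sum ?s ({..<i} \<union> {i..<n}) = (\<Sum>j<i. ?s j) + (\<Sum>j=i..<n. ?s j)"
      by (rule sum.union_disjoint) auto
    ultimately have "(\<Sum>j<n. ?s j) = (\<Sum>j<i. ?s j) + (\<Sum>j=i..<n. ?s j)" by simp
    then have "inner_iterate \<beta> h p w m i - inner_iterate \<beta> h p w m n
        = (h / real n) *\<^sub>R (\<Sum>j=i..<n. ?s j)"
      unfolding inner_iterate_eq[of \<beta> h p w m i] inner_iterate_eq[of \<beta> h p w m n]
      by (simp only: scaleR_add_right) simp
    moreover have "{i..<n} \<subseteq> {..<n}" by auto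
    ultimately show ?thesis
      using partial_step_norm_sq_le[OF perm _ \<beta>, of "{i..<n}" h m w] by (simp only:)
  qed
  from mean_sq_le[of "\<lambda>i. inner_iterate \<beta> h p w m i - inner_iterate \<beta> h p w m n", OF this]
  show ?thesis unfolding end_drift_def[symmetric] .
qed

text \<open>One epoch is a gradient step with the direction \<open>\<beta> *\<^sub>R m + (1 - \<beta>) *\<^sub>R v\<close> instead of the true
  gradient, where \<open>v\<close> is the mean gradient of the epoch; the two errors enter with weights \<open>\<beta>\<close> and
  \<open>1 - \<beta>\<close>.\<close>

lemma epoch_descent:
  assumes perm: "p permutes {1..n}" and \<beta>: "0 \<le> \<beta>" "\<beta> \<le> 1" and h: "0 \<le> h" "L * h \<le> 1"
  shows "F (inner_iterate \<beta> h p w m n)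
       \<le> F w - h / 2 * (norm (grad F w))\<^sup>2
         + h / 2 * (\<beta> * (norm (grad F w - m))\<^sup>2 + (1 - \<beta>) * start_drift \<beta> h p w m)"
proof -
  define v where "v = epoch_mean \<beta> h p w m"
  define u where "u = \<beta> *\<^sub>R m + (1 - \<beta>) *\<^sub>R v"
  have step: "inner_iterate \<beta> h p w m n = w - h *\<^sub>R u"
    by (simp add: epoch_step u_def v_def)
  have "F (w - h *\<^sub>R u) \<le> F w - h * (grad F w \<bullet> u) + L / 2 * (h\<^sup>2 * (norm u)\<^sup>2)"
    using objective_descent[of "w - h *\<^sub>R u" w] by (simp add: power_mult_distrib)
  also have "L / 2 * (h\<^sup>2 * (norm u)\<^sup>2) \<le> h / 2 * (norm u)\<^sup>2"
  proof -
    have "(L * h) * (h / 2 * (norm u)\<^sup>2) \<le> 1 * (h / 2 * (norm u)\<^sup>2)"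
      using h by (intro mult_right_mono) auto
    then show ?thesis by (simp add: power2_eq_square mult_ac)
  qed
  also have "F w - h * (grad F w \<bullet> u) + h / 2 * (norm u)\<^sup>2
      = F w - h / 2 * (norm (grad F w))\<^sup>2 + h / 2 * (norm (grad F w - u))\<^sup>2"
    by (simp add: power2_norm_eq_inner inner_diff_left inner_diff_right inner_commute field_simps)
  also have "grad F w - u = \<beta> *\<^sub>R (grad F w - m) + (1 - \<beta>) *\<^sub>R (grad F w - v)"
    by (simp add: u_def algebra_simps)
  finally have *: "F (w - h *\<^sub>R u) \<le> F w - h / 2 * (norm (grad F w))\<^sup>2
      + h / 2 * (norm (\<beta> *\<^sub>R (grad F w - m) + (1 - \<beta>) *\<^sub>R (grad F w - v)))\<^sup>2"
    by simp
  have "(norm (\<beta> *\<^sub>R (grad F w - m) + (1 - \<beta>) *\<^sub>R (grad F w - v)))\<^sup>2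
      \<le> \<beta> * (norm (grad F w - m))\<^sup>2 + (1 - \<beta>) * (norm (grad F w - v))\<^sup>2"
    by (rule norm_sq_convex_combination_le[OF \<beta>])
  also have "\<dots> \<le> \<beta> * (norm (grad F w - m))\<^sup>2 + (1 - \<beta>) * start_drift \<beta> h p w m"
    using \<beta> epoch_mean_near_start[OF perm] by (intro add_left_mono mult_left_mono) (auto simp: v_def)
  finally have "h / 2 * (norm (\<beta> *\<^sub>R (grad F w - m) + (1 - \<beta>) *\<^sub>R (grad F w - v)))\<^sup>2
      \<le> h / 2 * (\<beta> * (norm (grad F w - m))\<^sup>2 + (1 - \<beta>) * start_drift \<beta> h p w m)"
    using h by (intro mult_left_mono) auto
  with * show ?thesis unfolding step by linarith
qed

lemma expectation_partial_mean_sq_le: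
  assumes A: "A \<subseteq> {..<n}"
  shows "measure_pmf.expectation (pmf_of_set {p. p permutes {1..n}}) (\<lambda>p. partial_mean_sq p A w)
           \<le> (1 + \<Theta> / real n) * (norm (grad F w))\<^sup>2 + \<sigma>\<^sup>2 / real n"
proof -
  have "(\<Sum>j\<in>A. grad (f (p (Suc j))) w) = (\<Sum>j\<in>Suc ` A. grad (f (p j)) w)" for p
    by (simp add: sum.reindex)
  moreover have "Suc ` A \<subseteq> {1..n}" "card {1..n} = n" using A by auto
  ultimately have "measure_pmf.expectation (pmf_of_set {p. p permutes {1..n}}) (\<lambda>p. partial_mean_sq p A w)
      \<le> (norm (grad F w))\<^sup>2
        + (1 / real n) * ((1 / real n) * (\<Sum>i=1..n. (norm (grad (f i) w - grad F w))\<^sup>2))"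
    using expectation_permutation_partial_mean_le[of "{1..n}" "Suc ` A" "\<lambda>i. grad (f i) w"]
    by (simp only: partial_mean_sq_def grad_objective finite_atLeastAtMost)
  also have "\<dots> \<le> (norm (grad F w))\<^sup>2 + (1 / real n) * (\<Theta> * (norm (grad F w))\<^sup>2 + \<sigma>\<^sup>2)"
    by (intro add_left_mono mult_left_mono variance_bound) simp
  finally show ?thesis by (simp add: algebra_simps add_divide_distrib)
qed

lemma expectation_mean_partial_mean_sq_le:
  assumes A: "\<And>i. i < n \<Longrightarrow> A i \<subseteq> {..<n}"
  shows "measure_pmf.expectation (pmf_of_set {p. p permutes {1..n}})
             (\<lambda>p. (1 / real n) * (\<Sum>i<n. partial_mean_sq p (A i) w))
           \<le> (1 + \<Theta> / real n) * (norm (grad F w))\<^sup>2 + \<sigma>\<^sup>2 / real n" (is "?E \<le> ?b")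
proof -
  have fin: "finite (set_pmf (pmf_of_set {p. p permutes {1..n}}))"
    by (intro finite_set_pmf_uniform_permutation finite_atLeastAtMost)
  have "?E = (1 / real n) * (\<Sum>i<n. measure_pmf.expectation (pmf_of_set {p. p permutes {1..n}})
      (\<lambda>p. partial_mean_sq p (A i) w))"
    by (simp only: integral_mult_right_zero,
        subst Bochner_Integration.integral_sum[OF integrable_measure_pmf_finite[OF fin]]) simp
  also have "\<dots> \<le> (1 / real n) * (\<Sum>i<n. ?b)"
    using A by (intro mult_left_mono sum_mono expectation_partial_mean_sq_le) auto
  also have "\<dots> = ?b" using n_pos by simp
  finally show ?thesis .
qed

end

section \<open>One step of the potential\<close>

text \<open>The arithmetic of one epoch. Here \<open>x\<close> is the expected squared gradient at its start, \<open>i\<close> and \<open>j\<close>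
  are the expected start and end drifts, \<open>jprev\<close> is the end drift of the previous epoch, \<open>p\<close> and \<open>a\<close> are
  the expected squared norm and squared error of the momentum, \<open>e\<close> is \<open>L\<^sup>2\<close> times the squared learning
  rate, \<open>\<kappa>\<close> and \<open>s\<close> stand for \<open>1 + \<Theta> / n\<close> and \<open>\<sigma>\<^sup>2 / n\<close>, and \<open>\<rho>\<close>, \<open>\<rho>'\<close> are the learning rates of this
  epoch and the next. The potential adds to the
  objective a multiple of the last end drift. Its weight \<open>\<beta> / 2 + 1 / 26\<close> solves
  \<open>\<beta> / 2 + ((1 - \<beta>) / 2 + \<theta>) / 14 = \<theta>\<close>, so the terms in \<open>jprev\<close> cancel.\<close>

lemma potential_step:
  fixes \<beta> e \<kappa> \<rho> \<rho>' x p s i j jprev a \<Phi> \<Phi>' :: real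
  assumes \<beta>: "0 \<le> \<beta>" "\<beta> < 1" and e: "0 \<le> e" "1 \<le> \<kappa>" "e * \<kappa> \<le> (1 - \<beta>) / (6 * (5 - 3 * \<beta>))"
    and \<rho>: "0 \<le> \<rho>'" "\<rho>' \<le> \<rho>"
    and nonneg: "0 \<le> x" "0 \<le> s" "0 \<le> i" "0 \<le> jprev"
    and a: "a \<le> jprev + x" and p: "p \<le> 2 * jprev + 2 * x"
    and i: "i \<le> e * (\<beta> * p + 2 * (1 - \<beta>) * (i + (\<kappa> * x + s)))"
    and j: "j \<le> e * (\<beta> * p + 2 * (1 - \<beta>) * (i + (\<kappa> * x + s)))"
    and descent: "\<Phi>' \<le> \<Phi> - \<rho> / 2 * x + \<rho> / 2 * (\<beta> * a + (1 - \<beta>) * i)"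
  shows "\<Phi>' + (\<beta> / 2 + 1 / 26) * \<rho>' * j
       \<le> \<Phi> + (\<beta> / 2 + 1 / 26) * \<rho> * jprev - (1 - \<beta>) / 4 * (\<rho> * x)
         + 15 / 13 * (1 - \<beta>) * (\<rho> * (e * s))"
proof -
  \<comment> \<open>The bounds on \<open>c\<close> rest on \<open>5 * (1 - \<beta>) \<le> 5 - 3 * \<beta>\<close> and \<open>2 * \<beta> \<le> 5 - 3 * \<beta>\<close>.\<close>
  define c where "c = (1 - \<beta>) / (6 * (5 - 3 * \<beta>))"
  have c: "c \<le> 1 / 30" "2 * \<beta> * c \<le> (1 - \<beta>) / 6"
  proof -
    show "c \<le> 1 / 30" using \<beta> by (simp add: c_def field_simps)
    have "2 * \<beta> * c = (1 - \<beta>) / 6 * (2 * \<beta> / (5 - 3 * \<beta>))"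
      by (simp only: c_def times_divide_times_eq times_divide_eq_right divide_divide_eq_left mult.commute mult.left_commute)
    also have "\<dots> \<le> (1 - \<beta>) / 6 * 1" using \<beta> by (intro mult_left_mono) (auto simp: field_simps)
    finally show "2 * \<beta> * c \<le> (1 - \<beta>) / 6" by simp
  qed
  have e\<kappa>: "e * \<kappa> \<le> c" "e \<le> c"
    using e mult_left_mono[of 1 \<kappa> e] by (auto simp: c_def)
  define R where "R = e * (\<beta> * p + 2 * (1 - \<beta>) * (\<kappa> * x + s))"
  have self: "e * (\<beta> * p + 2 * (1 - \<beta>) * (i + (\<kappa> * x + s))) \<le> R + i / 15"
  proof -
    have "(2 * (1 - \<beta>) * e) * i \<le> 1 / 15 * i"
    proof (rule mult_right_mono[OF _ nonneg(3)])
      have "(1 - \<beta>) * e \<le> 1 * e" using \<beta> e by (intro mult_right_mono) auto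
      then show "2 * (1 - \<beta>) * e \<le> 1 / 15" using e\<kappa> c by linarith
    qed
    then show ?thesis by (simp add: R_def algebra_simps)
  qed
  have iR: "i \<le> 15 / 14 * R" using i self by linarith
  then have jR: "j \<le> 15 / 14 * R" using j self by linarith
  have R: "R \<le> jprev / 15 + 7 / 30 * (1 - \<beta>) * x + 2 * (1 - \<beta>) * (e * s)"
  proof -
    have "e * \<beta> * p \<le> e * \<beta> * (2 * jprev + 2 * x)"
      using \<beta> e p by (intro mult_left_mono) auto
    moreover have "2 * (e * \<beta>) * jprev \<le> 1 / 15 * jprev"
    proof (rule mult_right_mono[OF _ nonneg(4)])
      have "e * \<beta> \<le> e * 1" using \<beta> e by (intro mult_left_mono) auto
      then show "2 * (e * \<beta>) \<le> 1 / 15" using e\<kappa> c by linarith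
    qed
    moreover have "2 * (e * \<beta>) * x \<le> (1 - \<beta>) / 6 * x"
    proof (rule mult_right_mono[OF _ nonneg(1)])
      have "e * \<beta> \<le> c * \<beta>" using \<beta> e\<kappa> by (intro mult_right_mono) auto
      then show "2 * (e * \<beta>) \<le> (1 - \<beta>) / 6" using c(2) by (simp add: mult.commute)
    qed
    moreover have "2 * (1 - \<beta>) * (e * \<kappa>) * x \<le> 2 * (1 - \<beta>) * (1 / 30) * x"
      using \<beta> e\<kappa> c nonneg by (intro mult_right_mono mult_left_mono) auto
    moreover have "R = e * \<beta> * p + 2 * (1 - \<beta>) * (e * \<kappa>) * x + 2 * (1 - \<beta>) * (e * s)"
      by (simp add: R_def algebra_simps)
    moreover have "e * \<beta> * (2 * jprev + 2 * x) = 2 * (e * \<beta>) * jprev + 2 * (e * \<beta>) * x"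
      by (simp add: algebra_simps)
    moreover have "(1 - \<beta>) / 6 * x + 2 * (1 - \<beta>) * (1 / 30) * x = 7 / 30 * (1 - \<beta>) * x"
      by (simp add: field_simps)
    ultimately show ?thesis by linarith
  qed
  define Q where "Q = jprev / 14 + (1 - \<beta>) * x / 4 + 15 / 7 * (1 - \<beta>) * (e * s)"
  have Q_eq: "Q = 15 / 14 * (jprev / 15 + 7 / 30 * (1 - \<beta>) * x + 2 * (1 - \<beta>) * (e * s))"
    by (simp add: Q_def field_simps)
  have RQ: "15 / 14 * R \<le> Q" unfolding Q_eq using R by (rule mult_left_mono) simp
  have Q: "0 \<le> Q" "i \<le> Q" "j \<le> Q" using iR jR RQ nonneg by linarith+
  have "(\<beta> / 2 + 1 / 26) * \<rho>' * j \<le> (\<beta> / 2 + 1 / 26) * \<rho>' * Q"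
    using \<beta> \<rho> Q by (intro mult_left_mono) auto
  also have "\<dots> \<le> (\<beta> / 2 + 1 / 26) * \<rho> * Q"
    using \<beta> \<rho> Q by (intro mult_right_mono mult_left_mono) auto
  finally have A: "(\<beta> / 2 + 1 / 26) * \<rho>' * j \<le> (\<beta> / 2 + 1 / 26) * \<rho> * Q" .
  have "\<beta> * a + (1 - \<beta>) * i \<le> \<beta> * (jprev + x) + (1 - \<beta>) * Q"
    using \<beta> a Q by (intro add_mono mult_left_mono) auto
  then have B: "\<rho> / 2 * (\<beta> * a + (1 - \<beta>) * i) \<le> \<rho> / 2 * (\<beta> * (jprev + x) + (1 - \<beta>) * Q)"
    using \<rho> by (intro mult_left_mono) auto
  have "0 \<le> (1 - \<beta>) * (\<rho> * x)" using \<beta> \<rho> nonneg by simp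
  with A B descent show ?thesis by (simp add: Q_def field_simps)
qed

section \<open>Reshuffled epochs in expectation\<close>

lemma reshuffling_support:
  assumes "\<pi> \<in> set_pmf (reshuffling_pmf n T)" "t \<in> {1..T}"
  shows "\<pi> t permutes {1..n}"
  using assms
  by (auto simp: reshuffling_pmf_def set_Pi_pmf PiE_dflt_def set_pmf_uniform_permutation)

lemma finite_reshuffling: "finite (set_pmf (reshuffling_pmf n T))"
  unfolding reshuffling_pmf_def
  by (subst set_Pi_pmf) (auto intro!: finite_PiE_dflt finite_set_pmf_uniform_permutation simp del: One_nat_def)

lemma smg_cong:
  assumes "\<And>s. 1 \<le> s \<Longrightarrow> s \<le> t \<Longrightarrow> \<pi> s = \<pi>' s"
  shows "smg n f \<beta> \<eta> w0 \<pi> t = smg n f \<beta> \<eta> w0 \<pi>' t"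
  using assms by (induction t) (simp_all add: Let_def case_prod_beta)

text \<open>A run over \<open>T\<close> epochs with nonincreasing learning rates, the first of which is small enough.
  Epochs are counted from zero below: epoch \<open>t\<close> uses the learning rate \<open>\<eta> (Suc t)\<close> and the permutation
  \<open>\<pi> (Suc t)\<close>.\<close>

locale smg_process = finite_sum n f L \<Theta> \<sigma>
  for n :: nat and f :: "nat \<Rightarrow> 'a::euclidean_space \<Rightarrow> real" and L \<Theta> \<sigma> :: real +
  fixes \<beta> :: real and \<eta> :: "nat \<Rightarrow> real" and w0 :: 'a and T :: nat
  assumes \<beta>: "0 \<le> \<beta>" "\<beta> < 1"
    and rate_pos: "\<And>t. 1 \<le> t \<Longrightarrow> 0 < \<eta> t"
    and rate_antimono: "\<And>s t. 1 \<le> s \<Longrightarrow> s \<le> t \<Longrightarrow> \<eta> t \<le> \<eta> s"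
    and first_rate: "L\<^sup>2 * (\<eta> 1)\<^sup>2 * (1 + \<Theta> / real n) \<le> (1 - \<beta>) / (6 * (5 - 3 * \<beta>))"
begin

text \<open>Starting point and momentum of epoch \<open>t\<close>, and the squared gradient norm at that point, as
  functions of the permutations.\<close>

definition iterate :: "(nat \<Rightarrow> nat \<Rightarrow> nat) \<Rightarrow> nat \<Rightarrow> 'a" where
  "iterate \<pi> t = smg_iterate n f \<beta> \<eta> w0 \<pi> t"

definition momentum :: "(nat \<Rightarrow> nat \<Rightarrow> nat) \<Rightarrow> nat \<Rightarrow> 'a" where
  "momentum \<pi> t = snd (smg n f \<beta> \<eta> w0 \<pi> t)"

definition sq_grad :: "(nat \<Rightarrow> nat \<Rightarrow> nat) \<Rightarrow> nat \<Rightarrow> real" where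
  "sq_grad \<pi> t = (norm (grad F (iterate \<pi> t)))\<^sup>2"

text \<open>The drifts within epoch \<open>t\<close>.\<close>

definition drift_start :: "(nat \<Rightarrow> nat \<Rightarrow> nat) \<Rightarrow> nat \<Rightarrow> real" where
  "drift_start \<pi> t = start_drift \<beta> (\<eta> (Suc t)) (\<pi> (Suc t)) (iterate \<pi> t) (momentum \<pi> t)"

definition drift_end :: "(nat \<Rightarrow> nat \<Rightarrow> nat) \<Rightarrow> nat \<Rightarrow> real" where
  "drift_end \<pi> t = end_drift \<beta> (\<eta> (Suc t)) (\<pi> (Suc t)) (iterate \<pi> t) (momentum \<pi> t)"

text \<open>For \<open>t > 0\<close> the end drift of the preceding epoch, which bounds the squared distance between the
  momentum and the gradient at the current point. There is no preceding epoch at \<open>t = 0\<close>, where the momentum is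
  zero and its error is the squared gradient itself.\<close>

definition momentum_error :: "(nat \<Rightarrow> nat \<Rightarrow> nat) \<Rightarrow> nat \<Rightarrow> real" where
  "momentum_error \<pi> t = (case t of 0 \<Rightarrow> 0 | Suc s \<Rightarrow> drift_end \<pi> s)"

text \<open>Expectation over the permutations.\<close>

definition mean :: "((nat \<Rightarrow> nat \<Rightarrow> nat) \<Rightarrow> real) \<Rightarrow> real" where
  "mean h = measure_pmf.expectation (reshuffling_pmf n T) h"

lemma integrable_reshuffling: "integrable (measure_pmf (reshuffling_pmf n T)) (h :: _ \<Rightarrow> real)"
  by (rule integrable_measure_pmf_finite[OF finite_reshuffling])

lemma mean_add: "mean (\<lambda>\<pi>. g \<pi> + h \<pi>) = mean g + mean h"
  and mean_cmult: "mean (\<lambda>\<pi>. c * h \<pi>) = c * mean h"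
  and mean_const: "mean (\<lambda>\<pi>. c) = c"
  unfolding mean_def
  by (simp_all add: Bochner_Integration.integral_add integrable_reshuffling)

lemma mean_mono:
  assumes "\<And>\<pi>. (\<And>t. t \<in> {1..T} \<Longrightarrow> \<pi> t permutes {1..n}) \<Longrightarrow> g \<pi> \<le> h \<pi>"
  shows "mean g \<le> mean h"
  unfolding mean_def
  by (intro integral_mono_AE integrable_reshuffling)
     (auto simp: AE_measure_pmf_iff simp del: One_nat_def intro!: assms intro: reshuffling_support)

lemma iterate_0: "iterate \<pi> 0 = w0" and momentum_0: "momentum \<pi> 0 = 0"
  by (simp_all add: iterate_def smg_iterate_def momentum_def)

lemma iterate_Suc: "iterate \<pi> (Suc t)
    = inner_iterate \<beta> (\<eta> (Suc t)) (\<pi> (Suc t)) (iterate \<pi> t) (momentum \<pi> t) n"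
  by (simp add: iterate_def smg_iterate_def momentum_def inner_iterate_def Let_def case_prod_beta)

lemma momentum_Suc: "momentum \<pi> (Suc t)
    = epoch_mean \<beta> (\<eta> (Suc t)) (\<pi> (Suc t)) (iterate \<pi> t) (momentum \<pi> t)"
  by (simp add: iterate_def smg_iterate_def momentum_def epoch_mean_def smg_inner_mean[symmetric]
      Let_def case_prod_beta)

text \<open>The starting point of epoch \<open>t\<close> depends on earlier permutations only.\<close>

lemma iterate_past: "iterate (\<pi>(Suc t := y)) t = iterate \<pi> t"
  unfolding iterate_def smg_iterate_def by (subst smg_cong[of t _ \<pi>]) auto

lemma momentum_error_nonneg: "0 \<le> momentum_error \<pi> t"
  by (auto simp: momentum_error_def drift_end_def end_drift_nonneg split: nat.split)

text \<open>The summand \<open>sq_grad \<pi> t\<close> in the first bound is needed only for the first epoch.\<close>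

lemma grad_momentum_sq_le:
  assumes "\<And>s. s \<in> {1..T} \<Longrightarrow> \<pi> s permutes {1..n}" "t \<le> T"
  shows "(norm (grad F (iterate \<pi> t) - momentum \<pi> t))\<^sup>2 \<le> momentum_error \<pi> t + sq_grad \<pi> t"
    and "(norm (momentum \<pi> t))\<^sup>2 \<le> 2 * momentum_error \<pi> t + 2 * sq_grad \<pi> t"
proof -
  have "(norm (grad F (iterate \<pi> t) - momentum \<pi> t))\<^sup>2 \<le> momentum_error \<pi> t + sq_grad \<pi> t \<and>
    (norm (momentum \<pi> t))\<^sup>2 \<le> 2 * momentum_error \<pi> t + 2 * sq_grad \<pi> t"
  proof (cases t)
    case 0
    then show ?thesis by (simp add: momentum_0 momentum_error_def sq_grad_def)
  next
    case (Suc s)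
    have "(norm (grad F (iterate \<pi> t) - momentum \<pi> t))\<^sup>2 \<le> momentum_error \<pi> t"
      using assms Suc unfolding Suc iterate_Suc momentum_Suc momentum_error_def drift_end_def
      by (auto intro!: epoch_mean_near_end)
    moreover have "(norm (momentum \<pi> t))\<^sup>2
        \<le> 2 * (norm (grad F (iterate \<pi> t) - momentum \<pi> t))\<^sup>2 + 2 * sq_grad \<pi> t"
      using norm_add_sq_le[of "momentum \<pi> t - grad F (iterate \<pi> t)" "grad F (iterate \<pi> t)"]
      by (simp add: sq_grad_def norm_minus_commute)
    ultimately show ?thesis by (simp add: sq_grad_def add_increasing2)
  qed
  then show "(norm (grad F (iterate \<pi> t) - momentum \<pi> t))\<^sup>2 \<le> momentum_error \<pi> t + sq_grad \<pi> t"
    and "(norm (momentum \<pi> t))\<^sup>2 \<le> 2 * momentum_error \<pi> t + 2 * sq_grad \<pi> t" by auto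
qed

text \<open>Conditioning on the past: the permutation of epoch \<open>t\<close> is drawn afresh while the starting
  point of the epoch stays fixed.\<close>

lemma mean_partial_mean_sq_le:
  assumes t: "t < T" and A: "\<And>i. i < n \<Longrightarrow> A i \<subseteq> {..<n}"
  shows "mean (\<lambda>\<pi>. (1 / real n) * (\<Sum>i<n. partial_mean_sq (\<pi> (Suc t)) (A i) (iterate \<pi> t)))
           \<le> (1 + \<Theta> / real n) * mean (\<lambda>\<pi>. sq_grad \<pi> t) + \<sigma>\<^sup>2 / real n"
proof -
  let ?h = "\<lambda>p w. (1 / real n) * (\<Sum>i<n. partial_mean_sq p (A i) w)"
  let ?U = "pmf_of_set {p. p permutes {1..n}}"
  have "mean (\<lambda>\<pi>. ?h (\<pi> (Suc t)) (iterate \<pi> t))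
      = mean (\<lambda>\<pi>. measure_pmf.expectation ?U (\<lambda>y. ?h ((\<pi>(Suc t := y)) (Suc t)) (iterate (\<pi>(Suc t := y)) t)))"
    unfolding mean_def reshuffling_pmf_def
    using t by (intro expectation_Pi_pmf_resample finite_set_pmf_uniform_permutation) auto
  also have "\<dots> = mean (\<lambda>\<pi>. measure_pmf.expectation ?U (\<lambda>y. ?h y (iterate \<pi> t)))"
    by (simp only: iterate_past fun_upd_same)
  also have "\<dots> \<le> mean (\<lambda>\<pi>. (1 + \<Theta> / real n) * sq_grad \<pi> t + \<sigma>\<^sup>2 / real n)"
    unfolding sq_grad_def by (intro mean_mono expectation_mean_partial_mean_sq_le A)
  finally show ?thesis by (simp only: mean_add mean_cmult mean_const)
qed

text \<open>The squared learning rate of epoch \<open>t\<close> in units of \<open>1 / L\<^sup>2\<close>.\<close>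

abbreviation e where "e t \<equiv> L\<^sup>2 * (\<eta> (Suc t))\<^sup>2"

lemma e_le: "e t * (1 + \<Theta> / real n) \<le> (1 - \<beta>) / (6 * (5 - 3 * \<beta>))"
proof -
  have "e t * (1 + \<Theta> / real n) \<le> L\<^sup>2 * (\<eta> 1)\<^sup>2 * (1 + \<Theta> / real n)"
    using rate_pos[of "Suc t"] rate_antimono[of 1 "Suc t"] Theta_nonneg
    by (intro mult_right_mono mult_left_mono power_mono) auto
  with first_rate show ?thesis by linarith
qed

lemma rate_smooth: "L * \<eta> (Suc t) \<le> 1"
proof -
  have "e t * 1 \<le> e t * (1 + \<Theta> / real n)"
    using Theta_nonneg by (intro mult_left_mono) auto
  also have "\<dots> \<le> (1 - \<beta>) / (6 * (5 - 3 * \<beta>))" by (rule e_le)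
  also have "\<dots> \<le> 1" using \<beta> by (simp add: field_simps)
  finally have "(L * \<eta> (Suc t))\<^sup>2 \<le> 1\<^sup>2" by (simp add: power_mult_distrib)
  then show ?thesis by (rule power2_le_imp_le) simp
qed

lemma mean_drift_le:
  assumes t: "t < T"
  defines "B \<equiv> e t * (\<beta> * mean (\<lambda>\<pi>. (norm (momentum \<pi> t))\<^sup>2) + 2 * (1 - \<beta>) *
    (mean (\<lambda>\<pi>. drift_start \<pi> t)
      + ((1 + \<Theta> / real n) * mean (\<lambda>\<pi>. sq_grad \<pi> t) + \<sigma>\<^sup>2 / real n)))"
  shows "mean (\<lambda>\<pi>. drift_start \<pi> t) \<le> B" and "mean (\<lambda>\<pi>. drift_end \<pi> t) \<le> B"
proof -
  have bound: "mean d \<le> B"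
    if A: "\<And>i. i < n \<Longrightarrow> A i \<subseteq> {..<n}"
      and d: "\<And>\<pi>. \<pi> (Suc t) permutes {1..n} \<Longrightarrow> d \<pi> \<le> e t * (\<beta> * (norm (momentum \<pi> t))\<^sup>2
          + 2 * (1 - \<beta>) * (drift_start \<pi> t
            + (1 / real n) * (\<Sum>i<n. partial_mean_sq (\<pi> (Suc t)) (A i) (iterate \<pi> t))))"
    for d and A :: "nat \<Rightarrow> nat set"
  proof -
    have "mean d \<le> mean (\<lambda>\<pi>. e t * (\<beta> * (norm (momentum \<pi> t))\<^sup>2
          + 2 * (1 - \<beta>) * (drift_start \<pi> t
            + (1 / real n) * (\<Sum>i<n. partial_mean_sq (\<pi> (Suc t)) (A i) (iterate \<pi> t)))))"
      using t by (intro mean_mono d) auto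
    also have "\<dots> = e t * (\<beta> * mean (\<lambda>\<pi>. (norm (momentum \<pi> t))\<^sup>2)
          + 2 * (1 - \<beta>) * (mean (\<lambda>\<pi>. drift_start \<pi> t)
            + mean (\<lambda>\<pi>. (1 / real n) * (\<Sum>i<n. partial_mean_sq (\<pi> (Suc t)) (A i) (iterate \<pi> t)))))"
      by (simp only: mean_add mean_cmult)
    also have "\<dots> \<le> B"
      unfolding B_def using \<beta> mean_partial_mean_sq_le[OF t A]
      by (intro mult_left_mono add_left_mono) auto
    finally show ?thesis .
  qed
  show "mean (\<lambda>\<pi>. drift_start \<pi> t) \<le> B"
  proof (rule bound[where A = "\<lambda>i. {..<i}"])
    fix \<pi> :: "nat \<Rightarrow> nat \<Rightarrow> nat" assume "\<pi> (Suc t) permutes {1..n}"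
    then show "drift_start \<pi> t \<le> e t * (\<beta> * (norm (momentum \<pi> t))\<^sup>2
          + 2 * (1 - \<beta>) * (drift_start \<pi> t
            + (1 / real n) * (\<Sum>i<n. partial_mean_sq (\<pi> (Suc t)) {..<i} (iterate \<pi> t))))"
      unfolding drift_start_def using \<beta> by (intro start_drift_le) auto
  qed auto
  show "mean (\<lambda>\<pi>. drift_end \<pi> t) \<le> B"
  proof (rule bound[where A = "\<lambda>i. {i..<n}"])
    fix \<pi> :: "nat \<Rightarrow> nat \<Rightarrow> nat" assume "\<pi> (Suc t) permutes {1..n}"
    then show "drift_end \<pi> t \<le> e t * (\<beta> * (norm (momentum \<pi> t))\<^sup>2
          + 2 * (1 - \<beta>) * (drift_start \<pi> t
            + (1 / real n) * (\<Sum>i<n. partial_mean_sq (\<pi> (Suc t)) {i..<n} (iterate \<pi> t))))"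
      unfolding drift_start_def drift_end_def using \<beta> by (intro end_drift_le) auto
  qed auto
qed

lemma mean_descent:
  assumes t: "t < T"
  shows "mean (\<lambda>\<pi>. F (iterate \<pi> (Suc t)))
     \<le> mean (\<lambda>\<pi>. F (iterate \<pi> t)) - \<eta> (Suc t) / 2 * mean (\<lambda>\<pi>. sq_grad \<pi> t)
       + \<eta> (Suc t) / 2 * (\<beta> * mean (\<lambda>\<pi>. (norm (grad F (iterate \<pi> t) - momentum \<pi> t))\<^sup>2)
           + (1 - \<beta>) * mean (\<lambda>\<pi>. drift_start \<pi> t))"
proof -
  have "mean (\<lambda>\<pi>. F (iterate \<pi> (Suc t)))
     \<le> mean (\<lambda>\<pi>. (F (iterate \<pi> t) + (- (\<eta> (Suc t) / 2)) * sq_grad \<pi> t)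
       + \<eta> (Suc t) / 2 * (\<beta> * (norm (grad F (iterate \<pi> t) - momentum \<pi> t))\<^sup>2
           + (1 - \<beta>) * drift_start \<pi> t))"
  proof (rule mean_mono)
    fix \<pi> assume perm: "\<And>t. t \<in> {1..T} \<Longrightarrow> \<pi> t permutes {1..n}"
    show "F (iterate \<pi> (Suc t)) \<le> (F (iterate \<pi> t) + (- (\<eta> (Suc t) / 2)) * sq_grad \<pi> t)
       + \<eta> (Suc t) / 2 * (\<beta> * (norm (grad F (iterate \<pi> t) - momentum \<pi> t))\<^sup>2
           + (1 - \<beta>) * drift_start \<pi> t)"
      using epoch_descent[of "\<pi> (Suc t)" \<beta> "\<eta> (Suc t)" "iterate \<pi> t" "momentum \<pi> t"]
        perm[of "Suc t"] t \<beta> rate_pos[of "Suc t"] rate_smooth[of t]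
      unfolding iterate_Suc sq_grad_def drift_start_def by simp
  qed
  then show ?thesis by (simp only: mean_add mean_cmult)
qed

text \<open>The inequality \<open>potential_step\<close>, summed over all epochs.\<close>

lemma weighted_sq_grad_sum:
  "(1 - \<beta>) / 4 * (\<Sum>t<T. \<eta> (Suc t) * mean (\<lambda>\<pi>. sq_grad \<pi> t))
     \<le> F w0 - objective_inf n f
       + 15 / 13 * (1 - \<beta>) * (\<Sum>t<T. \<eta> (Suc t) * (e t * (\<sigma>\<^sup>2 / real n)))"
proof -
  define \<Psi> where "\<Psi> t = mean (\<lambda>\<pi>. F (iterate \<pi> t))
    + (\<beta> / 2 + 1 / 26) * \<eta> (Suc t) * mean (\<lambda>\<pi>. momentum_error \<pi> t)" for t
  have nonneg: "0 \<le> mean h" if "\<And>\<pi>. 0 \<le> h \<pi>" for h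
    using that mean_mono[of "\<lambda>_. 0" h] by (simp add: mean_const)
  have "\<Psi> k + (1 - \<beta>) / 4 * (\<Sum>t<k. \<eta> (Suc t) * mean (\<lambda>\<pi>. sq_grad \<pi> t))
      \<le> \<Psi> 0 + 15 / 13 * (1 - \<beta>) * (\<Sum>t<k. \<eta> (Suc t) * (e t * (\<sigma>\<^sup>2 / real n)))"
    if "k \<le> T" for k
    using that
  proof (induction k)
    case 0
    then show ?case by simp
  next
    case (Suc t)
    then have t: "t < T" by simp
    have "mean (\<lambda>\<pi>. (norm (grad F (iterate \<pi> t) - momentum \<pi> t))\<^sup>2)
        \<le> mean (\<lambda>\<pi>. momentum_error \<pi> t) + mean (\<lambda>\<pi>. sq_grad \<pi> t)"
      unfolding mean_add[symmetric] using t by (intro mean_mono grad_momentum_sq_le) auto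
    moreover have "mean (\<lambda>\<pi>. (norm (momentum \<pi> t))\<^sup>2)
        \<le> 2 * mean (\<lambda>\<pi>. momentum_error \<pi> t) + 2 * mean (\<lambda>\<pi>. sq_grad \<pi> t)"
      unfolding mean_add[symmetric] mean_cmult[symmetric]
      using t by (intro mean_mono grad_momentum_sq_le) auto
    moreover have "mean (\<lambda>\<pi>. momentum_error \<pi> (Suc t)) = mean (\<lambda>\<pi>. drift_end \<pi> t)"
      by (simp add: momentum_error_def)
    moreover have "0 \<le> mean (\<lambda>\<pi>. sq_grad \<pi> t)" "0 \<le> mean (\<lambda>\<pi>. drift_start \<pi> t)"
      "0 \<le> mean (\<lambda>\<pi>. momentum_error \<pi> t)"
      by (intro nonneg, simp add: sq_grad_def drift_start_def start_drift_nonneg momentum_error_nonneg)+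
    ultimately have "\<Psi> (Suc t) \<le> \<Psi> t - (1 - \<beta>) / 4 * (\<eta> (Suc t) * mean (\<lambda>\<pi>. sq_grad \<pi> t))
         + 15 / 13 * (1 - \<beta>) * (\<eta> (Suc t) * (e t * (\<sigma>\<^sup>2 / real n)))"
      unfolding \<Psi>_def
      using \<beta> e_le[of t] mean_descent[OF t] mean_drift_le[OF t] rate_pos[of "Suc (Suc t)"]
        rate_antimono[of "Suc t" "Suc (Suc t)"] Theta_nonneg
      by (intro potential_step[where \<kappa> = "1 + \<Theta> / real n"]) auto
    then show ?case using Suc by (simp add: distrib_left)
  qed
  from this[of T] have "\<Psi> T + (1 - \<beta>) / 4 * (\<Sum>t<T. \<eta> (Suc t) * mean (\<lambda>\<pi>. sq_grad \<pi> t))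
      \<le> \<Psi> 0 + 15 / 13 * (1 - \<beta>) * (\<Sum>t<T. \<eta> (Suc t) * (e t * (\<sigma>\<^sup>2 / real n)))" by simp
  moreover have "\<Psi> 0 = F w0" by (simp add: \<Psi>_def iterate_0 momentum_error_def mean_const)
  moreover have "objective_inf n f \<le> \<Psi> T"
  proof -
    have "objective_inf n f \<le> mean (\<lambda>\<pi>. F (iterate \<pi> T))"
      using mean_mono[of "\<lambda>_. objective_inf n f" "\<lambda>\<pi>. F (iterate \<pi> T)"]
      by (simp add: mean_const objective_inf_le)
    moreover have "0 \<le> (\<beta> / 2 + 1 / 26) * \<eta> (Suc T) * mean (\<lambda>\<pi>. momentum_error \<pi> T)"
      using \<beta> rate_pos[of "Suc T"] by (intro mult_nonneg_nonneg nonneg momentum_error_nonneg) auto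
    ultimately show ?thesis by (simp add: \<Psi>_def)
  qed
  ultimately show ?thesis by linarith
qed

text \<open>Output epoch and permutations are independent, so the expectation is an average of the
  expected squared gradients, weighted by the learning rates.\<close>

lemma smg_expected_sq_grad_eq:
  assumes "1 \<le> T"
  shows "smg_expected_sq_grad n f \<beta> \<eta> w0 T
    = (\<Sum>t<T. \<eta> (Suc t) * mean (\<lambda>\<pi>. sq_grad \<pi> t)) / (\<Sum>t<T. \<eta> (Suc t))"
proof -
  define S where "S = (\<Sum>s=1..T. \<eta> s)"
  have pmf: "pmf (epoch_pmf \<eta> T) t = (if t \<in> {1..T} then \<eta> t / S else 0)" for t
    unfolding S_def using assms rate_pos by (intro pmf_epoch_pmf) auto
  have supp: "set_pmf (epoch_pmf \<eta> T) \<subseteq> {1..T}"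
    by (auto simp: set_pmf_eq pmf split: if_splits)
  let ?g = "\<lambda>(\<pi>, t). (norm (grad F (smg_iterate n f \<beta> \<eta> w0 \<pi> (t - 1))))\<^sup>2"
  have "pair_pmf (reshuffling_pmf n T) (epoch_pmf \<eta> T)
      = epoch_pmf \<eta> T \<bind> (\<lambda>t. map_pmf (\<lambda>\<pi>. (\<pi>, t)) (reshuffling_pmf n T))"
    unfolding pair_pmf_def map_pmf_def by (rule bind_commute_pmf)
  then have "smg_expected_sq_grad n f \<beta> \<eta> w0 T = measure_pmf.expectation
      (epoch_pmf \<eta> T \<bind> (\<lambda>t. map_pmf (\<lambda>\<pi>. (\<pi>, t)) (reshuffling_pmf n T))) ?g"
    by (simp add: smg_expected_sq_grad_def)
  also have "\<dots> = (\<Sum>t=1..T. pmf (epoch_pmf \<eta> T) t *\<^sub>R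
      measure_pmf.expectation (map_pmf (\<lambda>\<pi>. (\<pi>, t)) (reshuffling_pmf n T)) ?g)"
    using supp finite_reshuffling by (intro pmf_expectation_bind) auto
  also have "\<dots> = (\<Sum>t=1..T. \<eta> t / S * mean (\<lambda>\<pi>. sq_grad \<pi> (t - 1)))"
    by (intro sum.cong refl) (simp add: pmf mean_def sq_grad_def iterate_def)
  also have "\<dots> = (\<Sum>t<T. \<eta> (Suc t) / S * mean (\<lambda>\<pi>. sq_grad \<pi> t))"
    by (simp add: sum.atLeast1_atMost_eq)
  also have "S = (\<Sum>t<T. \<eta> (Suc t))" by (simp add: S_def sum.atLeast1_atMost_eq)
  finally show ?thesis by (simp add: sum_divide_distrib)
qed

text \<open>The bound for an arbitrary nonincreasing sequence of learning rates.\<close>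

lemma smg_bound:
  assumes "1 \<le> T"
  shows "smg_expected_sq_grad n f \<beta> \<eta> w0 T
    \<le> (4 * (F w0 - objective_inf n f) / (1 - \<beta>)
        + 6 * \<sigma>\<^sup>2 * (5 - 3 * \<beta>) * L\<^sup>2 / (real n * (1 - \<beta>)) * (\<Sum>t<T. (\<eta> (Suc t)) ^ 3))
      / (\<Sum>t<T. \<eta> (Suc t))"
proof -
  define X where "X = (\<Sum>t<T. \<eta> (Suc t) * mean (\<lambda>\<pi>. sq_grad \<pi> t))"
  define C where "C = (\<Sum>t<T. (\<eta> (Suc t)) ^ 3)"
  define b where "b = 1 - \<beta>"
  define q where "q = L\<^sup>2 * (\<sigma>\<^sup>2 / real n) * C"
  have b: "0 < b" "b \<le> 1" using \<beta> by (auto simp: b_def)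
  have C: "0 \<le> C" unfolding C_def using rate_pos by (intro sum_nonneg) (auto intro: less_imp_le)
  then have q: "0 \<le> q" by (simp add: q_def)
  have "(\<Sum>t<T. \<eta> (Suc t) * (e t * (\<sigma>\<^sup>2 / real n))) = q"
    by (simp add: C_def q_def sum_distrib_left power2_eq_square power3_eq_cube mult_ac)
  then have "b / 4 * X \<le> (F w0 - objective_inf n f) + 15 / 13 * b * q"
    using weighted_sq_grad_sum by (simp add: X_def b_def)
  \<comment> \<open>The constant is enlarged to the claimed one; \<open>5 - 3 * \<beta> > 2\<close> leaves ample room.\<close>
  also have "15 / 13 * b * q \<le> 3 / 2 * (5 - 3 * \<beta>) * q"
    using b q \<beta> by (intro mult_right_mono) (auto simp: b_def)
  finally have "X \<le> (4 * (F w0 - objective_inf n f) + 6 * (5 - 3 * \<beta>) * q) / b"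
    using b by (simp add: field_simps)
  also have "\<dots> = 4 * (F w0 - objective_inf n f) / b
      + 6 * \<sigma>\<^sup>2 * (5 - 3 * \<beta>) * L\<^sup>2 / (real n * b) * C"
    by (simp add: q_def add_divide_distrib mult_ac)
  finally have X: "X \<le> \<dots>" .
  have "0 < (\<Sum>t<T. \<eta> (Suc t))"
    using assms rate_pos by (intro sum_pos) (auto simp: lessThan_empty_iff)
  then show ?thesis
    using X unfolding smg_expected_sq_grad_eq[OF assms] X_def[symmetric] C_def[symmetric] b_def[symmetric]
    by (intro divide_right_mono) auto
qed

end

section \<open>Diminishing learning rates\<close>

lemma powr_two_thirds: "0 < x \<Longrightarrow> x powr (2/3) = x / x powr (1/3)" for x :: real
proof -
  assume x: "0 < x"
  have "x powr (2/3) = x powr (1 - 1/3)" by simp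
  also have "\<dots> = x / x powr (1/3)" using x by (subst powr_diff) simp
  finally show ?thesis .
qed

lemma powr_third_cube: "0 < x \<Longrightarrow> (x powr (1/3)) ^ 3 = x" for x :: real
  by (simp add: powr_power)

lemma powr_third_square: "0 < x \<Longrightarrow> (x powr (1/3))\<^sup>2 = x powr (2/3)" for x :: real
  by (simp add: powr_power)

text \<open>The increment of \<open>a powr (2/3)\<close> from \<open>a\<close> to \<open>a + 1\<close> is at most \<open>1 / a powr (1/3)\<close>, so the sum
  telescopes.\<close>

lemma sum_inverse_cube_root_ge:
  fixes lam :: real
  assumes "0 \<le> lam"
  shows "(real k + lam) powr (2/3) - (1 + lam) powr (2/3)
           \<le> (\<Sum>t<k. 1 / (real (Suc t) + lam) powr (1/3))"
proof -
  have step: "(a + 1) powr (2/3) \<le> a powr (2/3) + 1 / a powr (1/3)" if "0 < a" for a :: real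
  proof -
    have "(a + 1) powr (2/3) = (a + 1) / (a + 1) powr (1/3)"
      using that by (intro powr_two_thirds) auto
    also have "\<dots> \<le> (a + 1) / a powr (1/3)"
      using that by (intro divide_left_mono powr_mono2 mult_pos_pos) auto
    also have "\<dots> = a powr (2/3) + 1 / a powr (1/3)"
      using that by (simp add: powr_two_thirds add_divide_distrib)
    finally show ?thesis .
  qed
  have "(real (Suc k) + lam) powr (2/3) - (1 + lam) powr (2/3)
      \<le> (\<Sum>t<k. 1 / (real (Suc t) + lam) powr (1/3))"
  proof (induction k)
    case 0
    then show ?case by simp
  next
    case (Suc k)
    then show ?case
      using step[of "real (Suc k) + lam"] assms by (simp add: add_ac)
  qed
  moreover have "(real k + lam) powr (2/3) \<le> (real (Suc k) + lam) powr (2/3)"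
    using assms by (intro powr_mono2) auto
  ultimately show ?thesis by linarith
qed

lemma sum_inverse_le:
  fixes lam :: real
  assumes lam: "0 \<le> lam" and T: "2 \<le> T"
  shows "(\<Sum>t<T. 1 / (real (Suc t) + lam)) \<le> 2 / (1 + lam) + ln (real T - 1 + lam)"
proof -
  have step: "1 / (a + 1) \<le> ln (a + 1) - ln a" if "0 < a" for a :: real
  proof -
    have "ln (a / (a + 1)) \<le> a / (a + 1) - 1" using that by (intro ln_le_minus_one) auto
    moreover have "a / (a + 1) - 1 = - (1 / (a + 1))" using that by (simp add: field_simps)
    ultimately show ?thesis using that by (simp add: ln_div)
  qed
  have head: "(\<Sum>t<Suc k. 1 / (real (Suc t) + lam)) \<le> 1 / (1 + lam) + ln (real (Suc k) + lam)" for k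
  proof (induction k)
    case 0
    then show ?case using lam by simp
  next
    case (Suc k)
    then show ?case
      using step[of "real (Suc k) + lam"] lam by (simp add: add_ac)
  qed
  obtain k where k: "T = Suc (Suc k)" using T by (metis Suc_le_D numeral_2_eq_2 Suc_le_mono)
  have "(\<Sum>t<T - 1. 1 / (real (Suc t) + lam)) \<le> 1 / (1 + lam) + ln (real T - 1 + lam)"
    using head[of k] by (simp add: k del: sum.lessThan_Suc)
  moreover have "(\<Sum>t<T. 1 / (real (Suc t) + lam))
      = (\<Sum>t<T - 1. 1 / (real (Suc t) + lam)) + 1 / (real T + lam)"
    by (simp add: k)
  moreover have "1 / (real T + lam) \<le> 1 / (1 + lam)"
    using T lam by (intro divide_left_mono) auto
  ultimately show ?thesis by simp
qed

text \<open>With \<open>u\<close> and \<open>v\<close> the cube roots of \<open>T + lam\<close> and \<open>1 + lam\<close>, the concavity of the power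
  \<open>2/3\<close> becomes the inequality \<open>2 * (u ^ 3 - v ^ 3) \<le> 3 * (u\<^sup>2 - v\<^sup>2) * u\<close>.\<close>

lemma powr_two_thirds_gap:
  fixes lam :: real
  assumes lam: "0 \<le> lam" and T: "2 \<le> T"
  shows "real T powr (2/3) / (3 * (1 + lam) powr (1/3))
           \<le> (real T + lam) powr (2/3) - (1 + lam) powr (2/3)"
proof -
  define u where "u = (real T + lam) powr (1/3)"
  define v where "v = (1 + lam) powr (1/3)"
  define d where "d = u\<^sup>2 - v\<^sup>2"
  have pos: "0 < u" "0 < v" using lam T by (auto simp: u_def v_def)
  have cubes: "u ^ 3 = real T + lam" "v ^ 3 = 1 + lam"
    using lam T by (simp_all add: u_def v_def powr_third_cube)
  have "0 \<le> (u - v)\<^sup>2 * (u + 2 * v)" using pos by simp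
  also have "\<dots> = 3 * (d * u) - 2 * (u ^ 3 - v ^ 3)"
    by (simp add: d_def power2_eq_square power3_eq_cube algebra_simps)
  finally have "real T / 3 \<le> d * u" using cubes T by simp
  moreover have "u \<le> real T powr (1/3) * v"
  proof -
    have "u \<le> (real T * (1 + lam)) powr (1/3)"
      unfolding u_def using lam T by (intro powr_mono2) (auto simp: distrib_left mult_le_cancel_right1)
    then show ?thesis using lam T by (simp add: v_def powr_mult)
  qed
  moreover have "0 < d"
  proof -
    have "0 < d * u" using \<open>real T / 3 \<le> d * u\<close> T by linarith
    then show ?thesis using pos by (simp add: zero_less_mult_iff)
  qed
  ultimately have "real T / 3 \<le> d * (real T powr (1/3) * v)"
    by (meson less_imp_le mult_left_mono order_trans)
  then have "real T powr (2/3) / (3 * v) \<le> d"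
    using T pos by (simp add: powr_two_thirds field_simps)
  moreover have "d = (real T + lam) powr (2/3) - (1 + lam) powr (2/3)"
    using lam T by (simp add: d_def u_def v_def powr_third_square)
  ultimately show ?thesis by (simp add: v_def)
qed

text \<open>For \<open>T \<ge> 2\<close> a constant depending on \<open>lam\<close> alone absorbs constants and the shift of the
  logarithm into \<open>ln T\<close>.\<close>

lemma ln_shift_le:
  fixes lam :: real
  assumes lam: "0 \<le> lam" and T: "2 \<le> T"
  defines "M \<equiv> 1 + (1 + ln (1 + lam)) / ln 2"
  shows "1 \<le> M * ln (real T)" and "ln (real T - 1 + lam) \<le> M * ln (real T)"
proof -
  have l: "ln 2 \<le> ln (real T)" "0 < ln (2::real)" using T by auto
  have nonneg: "0 \<le> ln (1 + lam)" using lam by simp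
  have ratio: "1 \<le> ln (real T) / ln 2" using l by simp
  have M: "M * ln (real T)
      = ln (real T) + ln (real T) / ln 2 + ln (1 + lam) * (ln (real T) / ln 2)"
    using l by (simp add: M_def field_simps)
  have *: "ln (1 + lam) \<le> ln (1 + lam) * (ln (real T) / ln 2)"
    using mult_left_mono[OF ratio nonneg] by simp
  show "1 \<le> M * ln (real T)" unfolding M using l ratio nonneg * by linarith
  have "ln (real T - 1 + lam) \<le> ln (real T * (1 + lam))"
  proof (subst ln_le_cancel_iff)
    show "real T - 1 + lam \<le> real T * (1 + lam)"
      using lam T mult_right_mono[of 1 "real T" lam] by (simp add: distrib_left)
  qed (use lam T in auto)
  also have "\<dots> = ln (real T) + ln (1 + lam)" using lam T by (simp add: ln_mult)
  finally show "ln (real T - 1 + lam) \<le> M * ln (real T)" unfolding M using ratio * by linarith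
qed

text \<open>Only the second argument of the maximum in \<open>D_const\<close> matters; it is never below \<open>30\<close>.\<close>

lemma admissible_first_rate:
  assumes "1 \<le> n" "0 < L" "0 \<le> \<Theta>" and adm: "admissible_params n L \<Theta> \<beta> \<gamma> lam"
  shows "L\<^sup>2 * (diminishing_rate n \<gamma> lam 1)\<^sup>2 * (1 + \<Theta> / real n)
           \<le> (1 - \<beta>) / (6 * (5 - 3 * \<beta>))"
proof -
  define D where "D = D_const n \<beta> \<Theta>"
  define \<kappa> where "\<kappa> = 1 + \<Theta> / real n"
  define h where "h = diminishing_rate n \<gamma> lam 1"
  have \<beta>: "0 \<le> \<beta>" "\<beta> < 1" and h: "h \<le> 1 / (L * sqrt D)" and \<gamma>: "0 < \<gamma>"
    using adm by (auto simp: admissible_params_def D_def h_def)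
  have D: "0 < D" by (simp add: D_def D_const_def less_max_iff_disj)
  have \<kappa>: "0 < \<kappa>" using assms by (simp add: \<kappa>_def add_pos_nonneg)
  have "6 * (5 - 3 * \<beta>) * (\<Theta> + real n) / (real n * (1 - \<beta>)) = 6 * (5 - 3 * \<beta>) * \<kappa> / (1 - \<beta>)"
    using assms \<beta> by (simp add: \<kappa>_def field_simps)
  then have D_ge: "6 * (5 - 3 * \<beta>) * \<kappa> / (1 - \<beta>) \<le> D" by (simp add: D_def D_const_def)
  have "0 \<le> h" using \<gamma> by (simp add: h_def diminishing_rate_def)
  then have "h\<^sup>2 \<le> (1 / (L * sqrt D))\<^sup>2" using h by (intro power_mono)
  then have "L\<^sup>2 * h\<^sup>2 \<le> 1 / D"
    using assms D by (simp add: power_divide power_mult_distrib field_simps)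
  then have "L\<^sup>2 * h\<^sup>2 * \<kappa> \<le> \<kappa> / D" using \<kappa> mult_right_mono by fastforce
  also have "\<dots> \<le> \<kappa> / (6 * (5 - 3 * \<beta>) * \<kappa> / (1 - \<beta>))"
    using D D_ge \<kappa> \<beta> by (intro divide_left_mono mult_pos_pos divide_pos_pos) auto
  also have "\<dots> = (1 - \<beta>) / (6 * (5 - 3 * \<beta>))" using \<kappa> by simp
  finally show ?thesis by (simp add: h_def \<kappa>_def)
qed

lemma smg_diminishing_bound:
  fixes f :: "nat \<Rightarrow> 'a::euclidean_space \<Rightarrow> real"
  assumes prob: "finite_sum_problem n f L \<Theta> \<sigma>" and adm: "admissible_params n L \<Theta> \<beta> \<gamma> lam"
    and lam: "0 \<le> lam" and T: "2 \<le> T"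
  shows "smg_expected_sq_grad n f \<beta> (diminishing_rate n \<gamma> lam) w0 T
         \<le> (C3_const (objective n f w0 - objective_inf n f) L \<sigma> \<beta> \<gamma> lam
              + C4_const L \<sigma> \<beta> \<gamma> * ln (real T - 1 + lam))
            / (real n powr (1/3) * ((real T + lam) powr (2/3) - (1 + lam) powr (2/3)))"
proof -
  interpret finite_sum n f L \<Theta> \<sigma> by unfold_locales (rule prob)
  define \<eta> where "\<eta> = diminishing_rate n \<gamma> lam"
  have \<beta>: "0 \<le> \<beta>" "\<beta> < 1" and \<gamma>: "0 < \<gamma>" using adm by (auto simp: admissible_params_def)
  have n: "0 < real n" by (rule n_pos)
  interpret smg_process n f L \<Theta> \<sigma> \<beta> \<eta> w0 T
  proof
    show "L\<^sup>2 * (\<eta> 1)\<^sup>2 * (1 + \<Theta> / real n) \<le> (1 - \<beta>) / (6 * (5 - 3 * \<beta>))"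
      unfolding \<eta>_def using n_pos L_pos Theta_nonneg adm by (intro admissible_first_rate) auto
    show "0 < \<eta> t" if "1 \<le> t" for t
      using that \<gamma> lam n by (simp add: \<eta>_def diminishing_rate_def)
    show "\<eta> t \<le> \<eta> s" if "1 \<le> s" "s \<le> t" for s t
      unfolding \<eta>_def diminishing_rate_def using that \<gamma> lam n
      by (intro divide_left_mono powr_mono2 mult_pos_pos) auto
  qed (rule \<beta>)+
  define \<Delta> where "\<Delta> = F w0 - objective_inf n f"
  define K where "K = 6 * \<sigma>\<^sup>2 * (5 - 3 * \<beta>) * L\<^sup>2 / (real n * (1 - \<beta>))"
  define l where "l = ln (real T - 1 + lam)"
  define d where "d = (real T + lam) powr (2/3) - (1 + lam) powr (2/3)"
  have nonneg: "0 \<le> \<Delta>" "0 \<le> K" "0 \<le> l"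
    using objective_inf_le[of w0] \<beta> n lam T by (auto simp: \<Delta>_def K_def l_def)
  have d: "0 < d" unfolding d_def using powr_less_mono2[of "2/3" "1 + lam" "real T + lam"] lam T by simp
  have "(\<Sum>t<T. (\<eta> (Suc t)) ^ 3) = \<gamma> ^ 3 * real n * (\<Sum>t<T. 1 / (real (Suc t) + lam))"
    unfolding sum_distrib_left using lam n
    by (intro sum.cong refl)
       (simp add: \<eta>_def diminishing_rate_def power_divide power_mult_distrib powr_third_cube)
  also have "\<dots> \<le> \<gamma> ^ 3 * real n * (2 / (1 + lam) + l)"
    unfolding l_def using sum_inverse_le[OF lam T] \<gamma> by (intro mult_left_mono) auto
  finally have "K * (\<Sum>t<T. (\<eta> (Suc t)) ^ 3) \<le> K * (\<gamma> ^ 3 * real n * (2 / (1 + lam) + l))"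
    using nonneg by (intro mult_left_mono)
  also have "4 * \<Delta> / (1 - \<beta>) + \<dots>
      = \<gamma> * (C3_const \<Delta> L \<sigma> \<beta> \<gamma> lam + C4_const L \<sigma> \<beta> \<gamma> * l)"
    using \<beta> \<gamma> n lam
    by (simp add: C3_const_def C4_const_def K_def divide_simps) algebra
  finally have num: "4 * \<Delta> / (1 - \<beta>) + K * (\<Sum>t<T. (\<eta> (Suc t)) ^ 3)
      \<le> \<gamma> * (C3_const \<Delta> L \<sigma> \<beta> \<gamma> lam + C4_const L \<sigma> \<beta> \<gamma> * l)" by simp
  have "\<gamma> * real n powr (1/3) * d \<le> \<gamma> * real n powr (1/3) * (\<Sum>t<T. 1 / (real (Suc t) + lam) powr (1/3))"
    unfolding d_def using sum_inverse_cube_root_ge[OF lam, of T] \<gamma> by (intro mult_left_mono) auto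
  also have "\<dots> = (\<Sum>t<T. \<eta> (Suc t))"
    by (simp add: sum_distrib_left \<eta>_def diminishing_rate_def)
  finally have den: "\<gamma> * real n powr (1/3) * d \<le> (\<Sum>t<T. \<eta> (Suc t))" .
  have "0 \<le> (\<Sum>t<T. (\<eta> (Suc t)) ^ 3)"
    using rate_pos by (intro sum_nonneg) (auto intro: less_imp_le)
  then have num_nonneg: "0 \<le> 4 * \<Delta> / (1 - \<beta>) + K * (\<Sum>t<T. (\<eta> (Suc t)) ^ 3)"
    using nonneg \<beta> by simp
  have "smg_expected_sq_grad n f \<beta> \<eta> w0 T
      \<le> (4 * \<Delta> / (1 - \<beta>) + K * (\<Sum>t<T. (\<eta> (Suc t)) ^ 3)) / (\<Sum>t<T. \<eta> (Suc t))"
    unfolding \<Delta>_def K_def using T by (intro smg_bound) simp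
  also have "\<dots> \<le> \<gamma> * (C3_const \<Delta> L \<sigma> \<beta> \<gamma> lam + C4_const L \<sigma> \<beta> \<gamma> * l) / (\<gamma> * real n powr (1/3) * d)"
    using num num_nonneg den \<gamma> n d by (intro frac_le) auto
  also have "\<dots> = (C3_const \<Delta> L \<sigma> \<beta> \<gamma> lam + C4_const L \<sigma> \<beta> \<gamma> * l) / (real n powr (1/3) * d)"
    using \<gamma> by simp
  finally show ?thesis by (simp add: \<eta>_def \<Delta>_def l_def d_def)
qed

theorem corollary6:
  fixes lam :: real
  assumes "0 \<le> lam"
  shows
    "(\<forall>(n::nat) (T::nat) (f :: nat \<Rightarrow> real ^ 'd::finite \<Rightarrow> real) (w0 :: real ^ 'd) L \<Theta> \<sigma> \<beta> \<gamma>.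
       finite_sum_problem n f L \<Theta> \<sigma> \<and> admissible_params n L \<Theta> \<beta> \<gamma> lam \<and> 2 \<le> T \<longrightarrow>
       smg_expected_sq_grad n f \<beta> (diminishing_rate n \<gamma> lam) w0 T
         \<le> (C3_const (objective n f w0 - objective_inf n f) L \<sigma> \<beta> \<gamma> lam
              + C4_const L \<sigma> \<beta> \<gamma> * ln (real T - 1 + lam))
            / (real n powr (1/3) * ((real T + lam) powr (2/3) - (1 + lam) powr (2/3))))
   \<and>
    (\<exists>K>0. \<forall>(n::nat) (T::nat) (f :: nat \<Rightarrow> real ^ 'd::finite \<Rightarrow> real) (w0 :: real ^ 'd) L \<Theta> \<sigma> \<beta> \<gamma>.
       finite_sum_problem n f L \<Theta> \<sigma> \<and> admissible_params n L \<Theta> \<beta> \<gamma> lam \<and> 2 \<le> T \<longrightarrow>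
       smg_expected_sq_grad n f \<beta> (diminishing_rate n \<gamma> lam) w0 T
         \<le> K * (C3_const (objective n f w0 - objective_inf n f) L \<sigma> \<beta> \<gamma> lam + C4_const L \<sigma> \<beta> \<gamma>)
            * (real n powr (-1/3) * real T powr (-2/3) * ln (real T)))"
proof (rule conjI)
  define M where "M = 1 + (1 + ln (1 + lam)) / ln 2"
  define K where "K = 3 * (1 + lam) powr (1/3) * M"
  have M: "0 < M" unfolding M_def using assms by (intro add_pos_nonneg divide_nonneg_nonneg) auto
  show "\<exists>K>0. \<forall>(n::nat) (T::nat) (f :: nat \<Rightarrow> real ^ 'd::finite \<Rightarrow> real) (w0 :: real ^ 'd) L \<Theta> \<sigma> \<beta> \<gamma>.
       finite_sum_problem n f L \<Theta> \<sigma> \<and> admissible_params n L \<Theta> \<beta> \<gamma> lam \<and> 2 \<le> T \<longrightarrow>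
       smg_expected_sq_grad n f \<beta> (diminishing_rate n \<gamma> lam) w0 T
         \<le> K * (C3_const (objective n f w0 - objective_inf n f) L \<sigma> \<beta> \<gamma> lam + C4_const L \<sigma> \<beta> \<gamma>)
            * (real n powr (-1/3) * real T powr (-2/3) * ln (real T))"
  proof (intro exI[of _ K] conjI allI impI, goal_cases)
    case 1
    show ?case using M assms by (simp add: K_def)
  next
    case (2 n T f w0 L \<Theta> \<sigma> \<beta> \<gamma>)
    then have prob: "finite_sum_problem n f L \<Theta> \<sigma>" and adm: "admissible_params n L \<Theta> \<beta> \<gamma> lam"
      and T: "2 \<le> T" by auto
    interpret finite_sum n f L \<Theta> \<sigma> by unfold_locales (rule prob)
    define C3 where "C3 = C3_const (objective n f w0 - objective_inf n f) L \<sigma> \<beta> \<gamma> lam"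
    define C4 where "C4 = C4_const L \<sigma> \<beta> \<gamma>"
    define d where "d = real T powr (2/3) / (3 * (1 + lam) powr (1/3))"
    define d' where "d' = (real T + lam) powr (2/3) - (1 + lam) powr (2/3)"
    have \<beta>: "0 \<le> \<beta>" "\<beta> < 1" and \<gamma>: "0 < \<gamma>" using adm by (auto simp: admissible_params_def)
    have C: "0 \<le> C3" "0 \<le> C4"
      using \<beta> \<gamma> assms objective_inf_le[of w0] by (auto simp: C3_def C4_def C3_const_def C4_const_def)
    have d: "0 < d" "d \<le> d'"
      unfolding d_def d'_def using T assms by (auto intro!: powr_two_thirds_gap)
    note ln_T = ln_shift_le[OF assms T, folded M_def]
    have "smg_expected_sq_grad n f \<beta> (diminishing_rate n \<gamma> lam) w0 T
        \<le> (C3 + C4 * ln (real T - 1 + lam)) / (real n powr (1/3) * d')"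
      unfolding C3_def C4_def d'_def by (rule smg_diminishing_bound[OF prob adm assms T])
    also have "\<dots> \<le> (C3 * (M * ln (real T)) + C4 * (M * ln (real T))) / (real n powr (1/3) * d)"
    proof (rule frac_le)
      show "C3 + C4 * ln (real T - 1 + lam) \<le> C3 * (M * ln (real T)) + C4 * (M * ln (real T))"
        using C ln_T mult_left_mono[OF ln_T(1) C(1)] by (intro add_mono mult_left_mono) auto
      show "0 \<le> C3 * (M * ln (real T)) + C4 * (M * ln (real T))" using C M T by simp
      show "real n powr (1/3) * d \<le> real n powr (1/3) * d'" using d by (intro mult_left_mono) auto
      show "0 < real n powr (1/3) * d" using d n_pos by simp
    qed
    also have "\<dots> = K * (C3 + C4) * (real n powr (-1/3) * real T powr (-2/3) * ln (real T))"
      using n_pos T assms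
      by (simp add: d_def K_def powr_minus_divide field_simps)
    finally show ?case unfolding C3_def C4_def .
  qed
qed (use assms smg_diminishing_bound in blast)

end
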